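(* Let $A$ be an abelian variety over a finite field $\mathbb{F}_q$, and let $K_1$ and $K_2$ be two oriented knots. Then the connected sum $K_1\# K_2$ is persistently $A$-colorable if and only if at least one of $K_1$ and $K_2$ is persistently $A$-colorable.
   Context: Quandles: a quandle is a nonempty set $Q$ with a binary operation $*$ such that $x*x=x$, each map $x\mapsto x*y$ is bijective, and $(x*y)*z=(x*z)*(y*z)$. For an abelian group $M$ and $\varphi\in\operatorname{Aut}(M)$, the Alexander quandle $Q(M,\varphi)$ is the set $M$ with $x*y=\varphi(x)+(1-\varphi)(y)$. Knots: the fundamental quandle $Q(K)$ of an oriented knot $K$ is the quandle generated by the arcs of an oriented diagram, with the standard relation $z=x*y$ at each crossing, where $y$ is the over-arc and $x,z$ are the under-arcs lying on two sides of $y$ fixed by a standard convention (say $x$ to the right of $y$, $z$ to the left). A coloring of $K$ by a quandle $Q$ is a quandle homomorphism $Q(K)\to Q$. For $A$ over $\mathbb{F}_q$ ($q$ a power of the prime $p$), $\pi_A$ is the $q$-power Frobenius endomorphism; for a prime $\ell\neq p$, $\pi_{A,\ell}$ is its restriction to the $\ell$-torsion group $A[\ell](\overline{\mathbb{F}}_q)$. $\Sigma_A(K)$ is the set of rational primes $\ell\ne p$ for which $K$ admits a nonconstant coloring by $Q(A[\ell](\overline{\mathbb{F}}_q),\pi_{A,\ell})$. $K$ is persistently $A$-colorable if $\Sigma_A(K)$ is infinite. *)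

theory Defs
  imports "HOL-Algebra.Algebraic_Closure_Type" "HOL-Library.Poly_Mapping"
    "HOL-Library.Cardinality"
begin

section \<open>Quandles\<close>

record 'a quandle_struct = "'a partial_object" +
  qop :: "'a \<Rightarrow> 'a \<Rightarrow> 'a"  (infixl \<open>\<triangleright>\<index>\<close> 70)

locale quandle =
  fixes Q :: "('a, 'b) quandle_struct_scheme" (structure)
  assumes nonempty: "carrier Q \<noteq> {}"
    and idem: "x \<in> carrier Q \<Longrightarrow> x \<triangleright> x = x"
    and bij: "y \<in> carrier Q \<Longrightarrow> bij_betw (\<lambda>x. x \<triangleright> y) (carrier Q) (carrier Q)"
    and distrib: "\<lbrakk>x \<in> carrier Q; y \<in> carrier Q; z \<in> carrier Q\<rbrakk>
      \<Longrightarrow> (x \<triangleright> y) \<triangleright> z = (x \<triangleright> z) \<triangleright> (y \<triangleright> z)"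

definition quandle_hom ::
  "('a, 'c) quandle_struct_scheme \<Rightarrow> ('b, 'd) quandle_struct_scheme \<Rightarrow> ('a \<Rightarrow> 'b) set" where
  "quandle_hom Q R = {f \<in> carrier Q \<rightarrow> carrier R.
     \<forall>x\<in>carrier Q. \<forall>y\<in>carrier Q. f (x \<triangleright>\<^bsub>Q\<^esub> y) = f x \<triangleright>\<^bsub>R\<^esub> f y}"

text \<open>Abelian groups are written multiplicatively: \<open>x * y = \<phi>(x) + y - \<phi>(y)\<close> is the operation.\<close>

definition alexander_quandle :: "('a, 'b) monoid_scheme \<Rightarrow> ('a \<Rightarrow> 'a) \<Rightarrow> 'a quandle_struct" where
  "alexander_quandle M \<phi> = \<lparr>carrier = carrier M,
     qop = (\<lambda>x y. \<phi> x \<otimes>\<^bsub>M\<^esub> (y \<otimes>\<^bsub>M\<^esub> inv\<^bsub>M\<^esub> (\<phi> y)))\<rparr>"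

lemma alexander_quandle_is_quandle:
  assumes "comm_group M" and "\<phi> \<in> iso M M"
  shows "quandle (alexander_quandle M \<phi>)"
proof -
  interpret comm_group M by fact
  have hom: "\<phi> \<in> hom M M" and bij: "bij_betw \<phi> (carrier M) (carrier M)"
    using assms(2) by (auto simp: iso_def)
  have cl [simp]: "\<phi> x \<in> carrier M" if "x \<in> carrier M" for x
    using hom that by (auto simp: hom_def)
  have mult [simp]: "\<phi> (x \<otimes>\<^bsub>M\<^esub> y) = \<phi> x \<otimes>\<^bsub>M\<^esub> \<phi> y" if "x \<in> carrier M" "y \<in> carrier M" for x y
    using hom that by (auto simp: hom_def)
  have inv [simp]: "\<phi> (inv\<^bsub>M\<^esub> x) = inv\<^bsub>M\<^esub> (\<phi> x)" if "x \<in> carrier M" for x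
    using group_hom.hom_inv[of M M \<phi> x] hom that
    by (simp add: group_hom_def group_hom_axioms_def is_group)
  let ?Q = "alexander_quandle M \<phi>"
  show ?thesis
  proof
    show "carrier ?Q \<noteq> {}" using one_closed by (auto simp: alexander_quandle_def)
  next
    fix x assume "x \<in> carrier ?Q"
    then show "x \<triangleright>\<^bsub>?Q\<^esub> x = x"
      by (simp add: alexander_quandle_def m_lcomm[of "\<phi> x" x])
  next
    fix y assume "y \<in> carrier ?Q"
    then have y: "y \<in> carrier M" by (simp add: alexander_quandle_def)
    have "bij_betw (\<lambda>x. x \<otimes>\<^bsub>M\<^esub> (y \<otimes>\<^bsub>M\<^esub> inv\<^bsub>M\<^esub> (\<phi> y))) (carrier M) (carrier M)"
      using y by (intro bij_betwI[where g = "\<lambda>x. x \<otimes>\<^bsub>M\<^esub> inv\<^bsub>M\<^esub> (y \<otimes>\<^bsub>M\<^esub> inv\<^bsub>M\<^esub> (\<phi> y))"])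
        (auto simp: m_assoc)
    from bij_betw_trans[OF bij this]
    show "bij_betw (\<lambda>x. x \<triangleright>\<^bsub>?Q\<^esub> y) (carrier ?Q) (carrier ?Q)"
      by (simp add: alexander_quandle_def o_def)
  next
    fix x y z assume "x \<in> carrier ?Q" "y \<in> carrier ?Q" "z \<in> carrier ?Q"
    then have c: "x \<in> carrier M" "y \<in> carrier M" "z \<in> carrier M"
      by (simp_all add: alexander_quandle_def)
    define b where "b = inv\<^bsub>M\<^esub> (\<phi> z)"
    have b: "b \<in> carrier M" "\<phi> b \<in> carrier M" "z \<otimes>\<^bsub>M\<^esub> b \<in> carrier M"
      "\<phi> z \<otimes>\<^bsub>M\<^esub> \<phi> b \<in> carrier M"
      using c by (auto simp: b_def)
    define w where "w = z \<otimes>\<^bsub>M\<^esub> b"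
    have w: "w \<in> carrier M" "\<phi> w \<in> carrier M" using b by (auto simp: w_def)
    have 1: "\<phi> w \<otimes>\<^bsub>M\<^esub> (w \<otimes>\<^bsub>M\<^esub> inv\<^bsub>M\<^esub> (\<phi> w)) = w"
      using w by (simp add: m_lcomm[of "\<phi> w" w])
    have ac: "(a \<otimes>\<^bsub>M\<^esub> e) \<otimes>\<^bsub>M\<^esub> ((b \<otimes>\<^bsub>M\<^esub> w) \<otimes>\<^bsub>M\<^esub> (c \<otimes>\<^bsub>M\<^esub> d)) = (a \<otimes>\<^bsub>M\<^esub> (b \<otimes>\<^bsub>M\<^esub> c)) \<otimes>\<^bsub>M\<^esub> (e \<otimes>\<^bsub>M\<^esub> (w \<otimes>\<^bsub>M\<^esub> d))"
      if "a \<in> carrier M" "b \<in> carrier M" "c \<in> carrier M" "d \<in> carrier M" "e \<in> carrier M" for a b c d e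
      using that w by (simp add: m_ac)
    have "((\<phi> x \<otimes>\<^bsub>M\<^esub> w) \<triangleright>\<^bsub>?Q\<^esub> (\<phi> y \<otimes>\<^bsub>M\<^esub> w))
      = (\<phi> (\<phi> x) \<otimes>\<^bsub>M\<^esub> \<phi> w) \<otimes>\<^bsub>M\<^esub> ((\<phi> y \<otimes>\<^bsub>M\<^esub> w) \<otimes>\<^bsub>M\<^esub> (inv\<^bsub>M\<^esub> (\<phi> (\<phi> y)) \<otimes>\<^bsub>M\<^esub> inv\<^bsub>M\<^esub> (\<phi> w)))"
      using c w by (simp add: alexander_quandle_def inv_mult)
    also have "\<dots> = (\<phi> (\<phi> x) \<otimes>\<^bsub>M\<^esub> (\<phi> y \<otimes>\<^bsub>M\<^esub> inv\<^bsub>M\<^esub> (\<phi> (\<phi> y)))) \<otimes>\<^bsub>M\<^esub> (\<phi> w \<otimes>\<^bsub>M\<^esub> (w \<otimes>\<^bsub>M\<^esub> inv\<^bsub>M\<^esub> (\<phi> w)))"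
      using c w by (intro ac) auto
    finally have "((\<phi> x \<otimes>\<^bsub>M\<^esub> w) \<triangleright>\<^bsub>?Q\<^esub> (\<phi> y \<otimes>\<^bsub>M\<^esub> w))
      = (\<phi> (\<phi> x) \<otimes>\<^bsub>M\<^esub> (\<phi> y \<otimes>\<^bsub>M\<^esub> inv\<^bsub>M\<^esub> (\<phi> (\<phi> y)))) \<otimes>\<^bsub>M\<^esub> w"
      unfolding 1 .
    then show "x \<triangleright>\<^bsub>?Q\<^esub> y \<triangleright>\<^bsub>?Q\<^esub> z = x \<triangleright>\<^bsub>?Q\<^esub> z \<triangleright>\<^bsub>?Q\<^esub> (y \<triangleright>\<^bsub>?Q\<^esub> z)"
      using c w b by (simp add: alexander_quandle_def w_def b_def)
  qed
qed

subsection \<open>Quandles given by generators and relations\<close>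

text \<open>The constructor \<open>QInv s t\<close> stands for the unique \<open>x\<close> with \<open>x * t = s\<close>.\<close>

datatype 'a qterm = Gen 'a | QOp "'a qterm" "'a qterm" | QInv "'a qterm" "'a qterm"

definition qterms :: "'a set \<Rightarrow> 'a qterm set" where
  "qterms S = {t. set_qterm t \<subseteq> S}"

inductive_set qpres_rel :: "'a set \<Rightarrow> ('a qterm \<times> 'a qterm) set \<Rightarrow> ('a qterm \<times> 'a qterm) set"
  for S :: "'a set" and R :: "('a qterm \<times> 'a qterm) set" where
  rel: "\<lbrakk>(s, t) \<in> R; s \<in> qterms S; t \<in> qterms S\<rbrakk> \<Longrightarrow> (s, t) \<in> qpres_rel S R"
| refl: "t \<in> qterms S \<Longrightarrow> (t, t) \<in> qpres_rel S R"
| sym: "(s, t) \<in> qpres_rel S R \<Longrightarrow> (t, s) \<in> qpres_rel S R"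
| trans: "\<lbrakk>(s, t) \<in> qpres_rel S R; (t, u) \<in> qpres_rel S R\<rbrakk> \<Longrightarrow> (s, u) \<in> qpres_rel S R"
| cong_op: "\<lbrakk>(s, s') \<in> qpres_rel S R; (t, t') \<in> qpres_rel S R\<rbrakk>
    \<Longrightarrow> (QOp s t, QOp s' t') \<in> qpres_rel S R"
| cong_inv: "\<lbrakk>(s, s') \<in> qpres_rel S R; (t, t') \<in> qpres_rel S R\<rbrakk>
    \<Longrightarrow> (QInv s t, QInv s' t') \<in> qpres_rel S R"
| idem: "t \<in> qterms S \<Longrightarrow> (QOp t t, t) \<in> qpres_rel S R"
| inv_op: "\<lbrakk>s \<in> qterms S; t \<in> qterms S\<rbrakk> \<Longrightarrow> (QInv (QOp s t) t, s) \<in> qpres_rel S R"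
| op_inv: "\<lbrakk>s \<in> qterms S; t \<in> qterms S\<rbrakk> \<Longrightarrow> (QOp (QInv s t) t, s) \<in> qpres_rel S R"
| distrib: "\<lbrakk>s \<in> qterms S; t \<in> qterms S; u \<in> qterms S\<rbrakk>
    \<Longrightarrow> (QOp (QOp s t) u, QOp (QOp s u) (QOp t u)) \<in> qpres_rel S R"

definition presented_quandle ::
  "'a set \<Rightarrow> ('a qterm \<times> 'a qterm) set \<Rightarrow> 'a qterm set quandle_struct" where
  "presented_quandle S R = \<lparr>carrier = qterms S // qpres_rel S R,
     qop = (\<lambda>C D. \<Union>s\<in>C. \<Union>t\<in>D. qpres_rel S R `` {QOp s t})\<rparr>"

lemma qpres_rel_qterms: "(s, t) \<in> qpres_rel S R \<Longrightarrow> s \<in> qterms S \<and> t \<in> qterms S"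
  by (induction rule: qpres_rel.induct) (auto simp: qterms_def)

lemma equiv_qpres_rel: "equiv (qterms S) (qpres_rel S R)"
  by (rule equivI)
    (auto simp: refl_on_def sym_def trans_def dest: qpres_rel_qterms
      intro: qpres_rel.refl qpres_rel.sym qpres_rel.trans)

lemma presented_quandle_op:
  assumes "s \<in> qterms S" "t \<in> qterms S"
  shows "(qpres_rel S R `` {s}) \<triangleright>\<^bsub>presented_quandle S R\<^esub> (qpres_rel S R `` {t})
    = qpres_rel S R `` {QOp s t}"
proof -
  have "congruent2 (qpres_rel S R) (qpres_rel S R) (\<lambda>s t. qpres_rel S R `` {QOp s t})"
    by (rule congruent2I')
      (rule equiv_class_eq[OF equiv_qpres_rel], blast intro: qpres_rel.cong_op)
  from UN_equiv_class2[OF equiv_qpres_rel equiv_qpres_rel this assms]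
  show ?thesis by (simp add: presented_quandle_def)
qed

lemma presented_quandle_is_quandle:
  assumes "S \<noteq> {}"
  shows "quandle (presented_quandle S R)"
proof -
  let ?Q = "presented_quandle S R" and ?r = "qpres_rel S R"
  let ?c = "\<lambda>t. ?r `` {t}"
  have car: "C \<in> carrier ?Q \<longleftrightarrow> (\<exists>t\<in>qterms S. C = ?c t)" for C
    by (auto simp: presented_quandle_def quotient_def)
  have carI: "?c t \<in> carrier ?Q" if "t \<in> qterms S" for t
    using that by (simp add: presented_quandle_def quotientI)
  have op_cl: "QOp s t \<in> qterms S" "QInv s t \<in> qterms S" if "s \<in> qterms S" "t \<in> qterms S" for s t
    using that by (auto simp: qterms_def)
  have eq: "?c s = ?c t" if "(s, t) \<in> ?r" for s t
    using equiv_class_eq[OF equiv_qpres_rel that] .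
  have eqD: "(s, t) \<in> ?r" if "?c s = ?c t" "t \<in> qterms S" for s t
    using eq_equiv_class[OF that(1) equiv_qpres_rel that(2)] .
  note op = presented_quandle_op
  show ?thesis
  proof
    obtain x where "x \<in> S" using assms by auto
    then have "Gen x \<in> qterms S" by (simp add: qterms_def)
    then have "?c (Gen x) \<in> carrier ?Q" by (rule carI)
    then show "carrier ?Q \<noteq> {}" by blast
  next
    fix C assume "C \<in> carrier ?Q"
    then obtain t where t: "t \<in> qterms S" "C = ?c t" unfolding car by blast
    show "C \<triangleright>\<^bsub>?Q\<^esub> C = C"
      unfolding t(2) op[OF t(1) t(1)] by (rule eq[OF qpres_rel.idem[OF t(1)]])
  next
    fix D assume "D \<in> carrier ?Q"
    then obtain t where t: "t \<in> qterms S" "D = ?c t" unfolding car by blast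
    show "bij_betw (\<lambda>C. C \<triangleright>\<^bsub>?Q\<^esub> D) (carrier ?Q) (carrier ?Q)"
      unfolding bij_betw_def
    proof (intro conjI inj_onI)
      fix A B assume "A \<in> carrier ?Q" "B \<in> carrier ?Q" and AB: "A \<triangleright>\<^bsub>?Q\<^esub> D = B \<triangleright>\<^bsub>?Q\<^esub> D"
      then obtain a b where a: "a \<in> qterms S" "A = ?c a" and b: "b \<in> qterms S" "B = ?c b"
        unfolding car by blast
      have "?c (QOp a t) = ?c (QOp b t)"
        using AB unfolding a(2) b(2) t(2) op[OF a(1) t(1)] op[OF b(1) t(1)] .
      then have "(QOp a t, QOp b t) \<in> ?r" by (rule eqD[OF _ op_cl(1)[OF b(1) t(1)]])
      then have "(QInv (QOp a t) t, QInv (QOp b t) t) \<in> ?r"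
        by (rule qpres_rel.cong_inv[OF _ qpres_rel.refl[OF t(1)]])
      then have "(a, b) \<in> ?r"
        by (rule qpres_rel.trans[OF qpres_rel.trans[OF
            qpres_rel.sym[OF qpres_rel.inv_op[OF a(1) t(1)]]] qpres_rel.inv_op[OF b(1) t(1)]])
      then show "A = B" unfolding a(2) b(2) by (rule eq)
    next
      show "(\<lambda>C. C \<triangleright>\<^bsub>?Q\<^esub> D) ` carrier ?Q = carrier ?Q"
      proof (intro equalityI subsetI)
        fix A assume "A \<in> (\<lambda>C. C \<triangleright>\<^bsub>?Q\<^esub> D) ` carrier ?Q"
        then obtain C where "C \<in> carrier ?Q" and A: "A = C \<triangleright>\<^bsub>?Q\<^esub> D" by (rule imageE)
        then obtain c where c: "c \<in> qterms S" "C = ?c c" unfolding car by blast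
        show "A \<in> carrier ?Q"
          unfolding A c(2) t(2) op[OF c(1) t(1)] by (rule carI[OF op_cl(1)[OF c(1) t(1)]])
      next
        fix A assume "A \<in> carrier ?Q"
        then obtain a where a: "a \<in> qterms S" "A = ?c a" unfolding car by blast
        have "A = ?c (QOp (QInv a t) t)"
          unfolding a(2) by (rule eq[OF qpres_rel.sym[OF qpres_rel.op_inv[OF a(1) t(1)]]])
        also have "\<dots> = ?c (QInv a t) \<triangleright>\<^bsub>?Q\<^esub> D"
          unfolding t(2) by (rule op[OF op_cl(2)[OF a(1) t(1)] t(1), symmetric])
        finally have "A = ?c (QInv a t) \<triangleright>\<^bsub>?Q\<^esub> D" .
        moreover have "?c (QInv a t) \<in> carrier ?Q"
          by (rule carI[OF op_cl(2)[OF a(1) t(1)]])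
        ultimately show "A \<in> (\<lambda>C. C \<triangleright>\<^bsub>?Q\<^esub> D) ` carrier ?Q" by (rule image_eqI)
      qed
    qed
  next
    fix A B C assume "A \<in> carrier ?Q" "B \<in> carrier ?Q" "C \<in> carrier ?Q"
    then obtain a b c where abc: "a \<in> qterms S" "b \<in> qterms S" "c \<in> qterms S"
      and ABC: "A = ?c a" "B = ?c b" "C = ?c c" unfolding car by blast
    show "A \<triangleright>\<^bsub>?Q\<^esub> B \<triangleright>\<^bsub>?Q\<^esub> C = A \<triangleright>\<^bsub>?Q\<^esub> C \<triangleright>\<^bsub>?Q\<^esub> (B \<triangleright>\<^bsub>?Q\<^esub> C)"
      unfolding ABC op[OF abc(1,2)] op[OF op_cl(1)[OF abc(1,2)] abc(3)] op[OF abc(1,3)]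
        op[OF abc(2,3)] op[OF op_cl(1)[OF abc(1,3)] op_cl(1)[OF abc(2,3)]]
      by (rule eq[OF qpres_rel.distrib[OF abc]])
  qed
qed

section \<open>Oriented knots\<close>

text \<open>
  An oriented knot diagram (on the two-sphere) is encoded by its signed Gauss code: the list of
  crossing passages met when travelling once along the knot from some base point. \<open>Over c s\<close> and
  \<open>Under c s\<close> are the passages along the upper and the lower strand of the crossing \<open>c\<close>, whose
  sign is positive iff \<open>s\<close>. The empty code is the circle without crossings.
\<close>

datatype passage = is_over: Over (crossing: nat) (positive: bool)
  | Under (crossing: nat) (positive: bool)

type_synonym gauss_code = "passage list"

definition crossings :: "gauss_code \<Rightarrow> nat set" where
  "crossings w = crossing ` set w"

definition wf_gauss_code :: "gauss_code \<Rightarrow> bool" where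
  "wf_gauss_code w \<longleftrightarrow> distinct w
     \<and> (\<forall>c s. Over c s \<in> set w \<longleftrightarrow> Under c s \<in> set w)
     \<and> (\<forall>c. \<not> (Over c True \<in> set w \<and> Over c False \<in> set w))"

text \<open>
  Edge \<open>i\<close> runs from the passage \<open>i - 1\<close> (cyclically) to the passage \<open>i\<close>; the circle without
  crossings has the single edge \<open>0\<close>.
\<close>

definition edges :: "gauss_code \<Rightarrow> nat set" where
  "edges w = {..<max 1 (length w)}"

definition next_edge :: "gauss_code \<Rightarrow> nat \<Rightarrow> nat" where
  "next_edge w i = Suc i mod length w"

definition prev_edge :: "gauss_code \<Rightarrow> nat \<Rightarrow> nat" where
  "prev_edge w i = (i + length w - 1) mod length w"

fun other_passage :: "passage \<Rightarrow> passage" where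
  "other_passage (Over c s) = Under c s"
| "other_passage (Under c s) = Over c s"

definition partner :: "gauss_code \<Rightarrow> nat \<Rightarrow> nat" where
  "partner w i = (THE j. j < length w \<and> w ! j = other_passage (w ! i))"

text \<open>
  At a positive crossing the lower strand passes from the right to the left of the upper strand,
  and hence the upper strand from the left to the right of the lower strand; at a negative crossing
  it is the other way around. \<open>crossed_leftwards w i\<close> says that the other strand passes from the
  right to the left of the strand of passage \<open>i\<close>.
\<close>

definition crossed_leftwards :: "gauss_code \<Rightarrow> nat \<Rightarrow> bool" where
  "crossed_leftwards w i \<longleftrightarrow> is_over (w ! i) = positive (w ! i)"

text \<open>
  \<open>(i, True)\<close> and \<open>(i, False)\<close> are edge \<open>i\<close> traversed along and against its orientation.
  \<open>face_step\<close> walks along the boundary of the face on the left: go to the end of the edge and take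
  the leftmost turn. The orbits are the faces of the surface carrying the diagram.
\<close>

fun face_step :: "gauss_code \<Rightarrow> nat \<times> bool \<Rightarrow> nat \<times> bool" where
  "face_step w (i, True) =
     (let j = partner w i in if crossed_leftwards w i then (next_edge w j, True) else (j, False))"
| "face_step w (i, False) =
     (let k = prev_edge w i; j = partner w k
      in if crossed_leftwards w k then (j, False) else (next_edge w j, True))"

definition faces :: "gauss_code \<Rightarrow> (nat \<times> bool) set set" where
  "faces w = (\<lambda>d. {(face_step w ^^ n) d | n. True}) ` (edges w \<times> UNIV)"

text \<open>
  A code with \<open>n > 0\<close> crossings has \<open>n\<close> vertices and \<open>2 n\<close> edges, so it is a diagram on the sphere
  iff its Euler characteristic \<open>n - 2 n + card (faces w)\<close> is \<open>2\<close>.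
\<close>

definition planar :: "gauss_code \<Rightarrow> bool" where
  "planar w \<longleftrightarrow> w = [] \<or> card (faces w) = card (crossings w) + 2"

definition knot_diagram :: "gauss_code \<Rightarrow> bool" where
  "knot_diagram w \<longleftrightarrow> wf_gauss_code w \<and> planar w"

fun rename_passage :: "(nat \<Rightarrow> nat) \<Rightarrow> passage \<Rightarrow> passage" where
  "rename_passage f (Over c s) = Over (f c) s"
| "rename_passage f (Under c s) = Under (f c) s"

definition ordered_pair :: "bool \<Rightarrow> 'a \<Rightarrow> 'a \<Rightarrow> 'a list" where
  "ordered_pair d x y = (if d then [x, y] else [y, x])"

text \<open>
  In the third move, crossing \<open>a\<close> is top over middle strand, \<open>b\<close> top over bottom, \<open>c\<close> middle over
  bottom, with signs \<open>s\<close>, \<open>t\<close>, \<open>r\<close>; the booleans \<open>dT\<close>, \<open>dM\<close>, \<open>dB\<close> record the order of the two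
  passages on each strand. The two sign conditions say that the three edges between these passages
  bound a triangle: for directions \<open>u\<close>, \<open>v\<close>, \<open>w\<close> of three lines with intersection points \<open>a\<close>, \<open>b\<close>,
  \<open>c\<close>, they follow from \<open>\<alpha> u + \<beta> w = \<mu> v\<close> (where \<open>b - a = \<alpha> u\<close>, \<open>c - b = \<beta> w\<close>, \<open>c - a = \<mu> v\<close>)
  on taking determinants with \<open>u\<close> and with \<open>w\<close>. The two third moves differ in the cyclic order in
  which the knot visits the strands.
\<close>

inductive move :: "gauss_code \<Rightarrow> gauss_code \<Rightarrow> bool" where
  rotate: "move (u @ v) (v @ u)"
| rename: "inj_on f (crossings u) \<Longrightarrow> move u (map (rename_passage f) u)"
| R1_over_under: "move u ([Over a s, Under a s] @ u)"
| R1_under_over: "move u ([Under a s, Over a s] @ u)"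
| R2: "move (u @ v)
    ([Over a s, Over b (\<not> s)] @ u @ ordered_pair d (Under a s) (Under b (\<not> s)) @ v)"
| R3: "\<lbrakk>(s = t) = (dM = dB); (t = r) = (dT = dM)\<rbrakk> \<Longrightarrow> move
    (ordered_pair dT (Over a s) (Over b t) @ u @ ordered_pair dM (Under a s) (Over c r) @ v
      @ ordered_pair dB (Under b t) (Under c r) @ x)
    (ordered_pair (\<not> dT) (Over a s) (Over b t) @ u @ ordered_pair (\<not> dM) (Under a s) (Over c r) @ v
      @ ordered_pair (\<not> dB) (Under b t) (Under c r) @ x)"
| R3': "\<lbrakk>(s = t) = (dM = dB); (t = r) = (dT = dM)\<rbrakk> \<Longrightarrow> move
    (ordered_pair dT (Over a s) (Over b t) @ u @ ordered_pair dB (Under b t) (Under c r) @ v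
      @ ordered_pair dM (Under a s) (Over c r) @ x)
    (ordered_pair (\<not> dT) (Over a s) (Over b t) @ u @ ordered_pair (\<not> dB) (Under b t) (Under c r) @ v
      @ ordered_pair (\<not> dM) (Under a s) (Over c r) @ x)"

definition diagram_move :: "gauss_code \<Rightarrow> gauss_code \<Rightarrow> bool" where
  "diagram_move w w' \<longleftrightarrow> knot_diagram w \<and> knot_diagram w' \<and> move w w'"

definition knot_equiv :: "gauss_code \<Rightarrow> gauss_code \<Rightarrow> bool" where
  "knot_equiv w w' \<longleftrightarrow> knot_diagram w \<and> knot_diagram w' \<and> equivclp diagram_move w w'"

lemma knot_diagram_Nil: "knot_diagram []"
  by (simp add: knot_diagram_def wf_gauss_code_def planar_def)

quotient_type knot = "gauss_code" / partial: knot_equiv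
proof (rule part_equivpI)
  show "\<exists>w. knot_equiv w w"
    using knot_diagram_Nil by (auto simp: knot_equiv_def)
  show "symp knot_equiv"
    unfolding symp_def knot_equiv_def using equivclp_sym[of diagram_move] by blast
  show "transp knot_equiv"
    unfolding transp_def knot_equiv_def using equivclp_trans[of diagram_move] by blast
qed

definition diagram_of :: "gauss_code \<Rightarrow> knot \<Rightarrow> bool" where
  "diagram_of w K \<longleftrightarrow> knot_diagram w \<and> abs_knot w = K"

lemma diagram_of_rep_knot: "diagram_of (rep_knot K) K"
  unfolding diagram_of_def
proof
  show "knot_diagram (rep_knot K)"
    using Quotient3_rep_reflp[OF Quotient3_knot, of K] by (simp add: knot_equiv_def)
  show "abs_knot (rep_knot K) = K"
    by (rule Quotient3_abs_rep[OF Quotient3_knot])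
qed

lemma diagram_of_iff_knot_equiv: "diagram_of w K \<longleftrightarrow> knot_equiv w (rep_knot K)"
proof -
  have refl: "knot_equiv v v \<longleftrightarrow> knot_diagram v" for v
    unfolding knot_equiv_def using equivclp_refl[of diagram_move v] by blast
  have K: "knot_diagram (rep_knot K)" "abs_knot (rep_knot K) = K"
    using diagram_of_rep_knot[of K] by (auto simp: diagram_of_def)
  show ?thesis
    using Quotient3_rel[OF Quotient3_knot, of w "rep_knot K"]
    by (simp add: diagram_of_def refl K)
qed

text \<open>
  The connected sum cuts both knots open at an edge and joins the ends coherently with the
  orientations. Every edge of a diagram on the sphere can be moved next to the base point by
  rotation, so on based codes this is concatenation. The sum is a relation because independence of
  the chosen diagrams and edges is a theorem about knots, not part of the construction.
\<close>

definition connected_sum :: "knot \<Rightarrow> knot \<Rightarrow> knot \<Rightarrow> bool" where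
  "connected_sum K\<^sub>1 K\<^sub>2 K \<longleftrightarrow> (\<exists>w\<^sub>1 w\<^sub>2. diagram_of w\<^sub>1 K\<^sub>1 \<and> diagram_of w\<^sub>2 K\<^sub>2
     \<and> crossings w\<^sub>1 \<inter> crossings w\<^sub>2 = {} \<and> diagram_of (w\<^sub>1 @ w\<^sub>2) K)"

subsection \<open>The fundamental quandle and colorings\<close>

text \<open>
  An arc is a maximal chain of edges that meet at over-passages.
\<close>

definition over_adjacent :: "gauss_code \<Rightarrow> nat \<Rightarrow> nat \<Rightarrow> bool" where
  "over_adjacent w i j \<longleftrightarrow> i < length w \<and> is_over (w ! i) \<and> j = next_edge w i"

definition arc_of :: "gauss_code \<Rightarrow> nat \<Rightarrow> nat set" where
  "arc_of w i = {j. equivclp (over_adjacent w) i j}"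

definition arcs :: "gauss_code \<Rightarrow> nat set set" where
  "arcs w = arc_of w ` edges w"

text \<open>
  The relation \<open>z = x * y\<close> at each crossing, with \<open>y\<close> the over-arc, \<open>x\<close> the under-arc to the right
  of \<open>y\<close> and \<open>z\<close> the one to the left: at a positive crossing \<open>x\<close> is the incoming under-arc, at a
  negative one it is the outgoing under-arc.
\<close>

definition crossing_relations :: "gauss_code \<Rightarrow> (nat set qterm \<times> nat set qterm) set" where
  "crossing_relations w =
     {(QOp (Gen (arc_of w j)) (Gen (arc_of w i)), Gen (arc_of w (next_edge w j))) | i j c.
        i < length w \<and> j < length w \<and> w ! i = Over c True \<and> w ! j = Under c True}
   \<union> {(QOp (Gen (arc_of w (next_edge w j))) (Gen (arc_of w i)), Gen (arc_of w j)) | i j c.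
        i < length w \<and> j < length w \<and> w ! i = Over c False \<and> w ! j = Under c False}"

definition diagram_quandle :: "gauss_code \<Rightarrow> nat set qterm set quandle_struct" where
  "diagram_quandle w = presented_quandle (arcs w) (crossing_relations w)"

text \<open>
  Up to isomorphism, this does not depend on the diagram \<open>rep_knot K\<close> chosen among those of \<open>K\<close>.
\<close>

definition fundamental_quandle :: "knot \<Rightarrow> nat set qterm set quandle_struct" where
  "fundamental_quandle K = diagram_quandle (rep_knot K)"

abbreviation colorings ::
  "knot \<Rightarrow> ('a, 'b) quandle_struct_scheme \<Rightarrow> (nat set qterm set \<Rightarrow> 'a) set" where
  "colorings K Q \<equiv> quandle_hom (fundamental_quandle K) Q"

definition nonconstant_coloring ::
  "knot \<Rightarrow> ('a, 'b) quandle_struct_scheme \<Rightarrow> (nat set qterm set \<Rightarrow> 'a) \<Rightarrow> bool" where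
  "nonconstant_coloring K Q f \<longleftrightarrow> f \<in> colorings K Q
     \<and> (\<exists>x\<in>carrier (fundamental_quandle K). \<exists>y\<in>carrier (fundamental_quandle K). f x \<noteq> f y)"

section \<open>Abelian varieties over a finite field\<close>

text \<open>
  A field type \<open>'k\<close> of class \<open>finite\<close> plays the role of the finite field with \<open>q = CARD('k)\<close>
  elements. Its algebraic closure is \<open>'k alg_closure\<close>, with embedding \<open>to_ac\<close>. Polynomials in
  variables indexed by \<open>'v\<close> are elements of \<open>('v \<Rightarrow>\<^sub>0 nat) \<Rightarrow>\<^sub>0 'c\<close>; evaluation takes the embedding of
  the coefficients as its first argument.
\<close>

definition peval :: "('c::zero \<Rightarrow> 'a::comm_semiring_1) \<Rightarrow> (('v \<Rightarrow>\<^sub>0 nat) \<Rightarrow>\<^sub>0 'c) \<Rightarrow> ('v \<Rightarrow> 'a) \<Rightarrow> 'a" where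
  "peval h f x = (\<Sum>m\<in>Poly_Mapping.keys f.
     h (Poly_Mapping.lookup f m) * (\<Prod>i\<in>Poly_Mapping.keys m. x i ^ Poly_Mapping.lookup m i))"

definition homogeneous :: "nat \<Rightarrow> (('v::finite \<Rightarrow>\<^sub>0 nat) \<Rightarrow>\<^sub>0 'c::zero) \<Rightarrow> bool" where
  "homogeneous d f \<longleftrightarrow> (\<forall>m\<in>Poly_Mapping.keys f. (\<Sum>i\<in>UNIV. Poly_Mapping.lookup m i) = d)"

definition bihomogeneous ::
  "nat \<Rightarrow> nat \<Rightarrow> (('v::finite + 'w::finite \<Rightarrow>\<^sub>0 nat) \<Rightarrow>\<^sub>0 'c::zero) \<Rightarrow> bool" where
  "bihomogeneous d e f \<longleftrightarrow> (\<forall>m\<in>Poly_Mapping.keys f.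
     (\<Sum>i\<in>UNIV. Poly_Mapping.lookup m (Inl i)) = d \<and> (\<Sum>i\<in>UNIV. Poly_Mapping.lookup m (Inr i)) = e)"

text \<open>
  A point of the projective space of dimension \<open>CARD('n) - 1\<close> is the set of all its vectors of
  homogeneous coordinates.
\<close>

type_synonym ('n, 'a) proj_point = "('n \<Rightarrow> 'a) set"

definition proj_point :: "('n \<Rightarrow> 'a::field) \<Rightarrow> ('n, 'a) proj_point" where
  "proj_point v = {\<lambda>i. c * v i | c. c \<noteq> 0}"

definition proj_space :: "('n, 'a::field) proj_point set" where
  "proj_space = {proj_point v | v. v \<noteq> (\<lambda>_. 0)}"

definition closed_over ::
  "('c::zero \<Rightarrow> 'a::field) \<Rightarrow> ('n::finite, 'a) proj_point set \<Rightarrow> bool" where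
  "closed_over h V \<longleftrightarrow> (\<exists>F :: (('n \<Rightarrow>\<^sub>0 nat) \<Rightarrow>\<^sub>0 'c) set. (\<forall>f\<in>F. \<exists>d. homogeneous d f)
     \<and> V = {P \<in> proj_space. \<forall>f\<in>F. \<forall>v\<in>P. peval h f v = 0})"

definition irreducible_closed :: "('n::finite, 'a::field) proj_point set \<Rightarrow> bool" where
  "irreducible_closed V \<longleftrightarrow> V \<noteq> {} \<and> closed_over id V
     \<and> (\<forall>Z\<^sub>1 Z\<^sub>2. closed_over id Z\<^sub>1 \<and> closed_over id Z\<^sub>2 \<and> V \<subseteq> Z\<^sub>1 \<union> Z\<^sub>2 \<longrightarrow> V \<subseteq> Z\<^sub>1 \<or> V \<subseteq> Z\<^sub>2)"

text \<open>
  A projective variety over \<open>'k\<close> is given by its points over the algebraic closure, and is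
  geometrically irreducible. As \<open>'k\<close> is perfect, closed subsets of the geometric points cut out by
  polynomials over \<open>'k\<close> correspond to geometrically reduced closed subschemes.
\<close>

definition projective_variety :: "('n::finite, 'k::field alg_closure) proj_point set \<Rightarrow> bool" where
  "projective_variety V \<longleftrightarrow> closed_over (to_ac :: 'k \<Rightarrow> _) V \<and> irreducible_closed V"

text \<open>
  Morphisms over \<open>'k\<close>: around every point, the map is given by homogeneous polynomials over \<open>'k\<close>
  (bihomogeneous ones on a product) of equal degree that do not vanish simultaneously there.
\<close>

definition regular_map ::
  "('n::finite, 'k::field alg_closure) proj_point set
   \<Rightarrow> (('n, 'k alg_closure) proj_point \<Rightarrow> ('m, 'k alg_closure) proj_point) \<Rightarrow> bool" where
  "regular_map V f \<longleftrightarrow> (\<forall>P\<in>V. \<exists>d. \<exists>F :: 'm \<Rightarrow> ('n \<Rightarrow>\<^sub>0 nat) \<Rightarrow>\<^sub>0 'k.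
     (\<forall>j. homogeneous d (F j))
     \<and> (\<forall>v\<in>P. \<exists>j. peval to_ac (F j) v \<noteq> 0)
     \<and> (\<forall>P'\<in>V. \<forall>v\<in>P'. (\<exists>j. peval to_ac (F j) v \<noteq> 0)
          \<longrightarrow> f P' = proj_point (\<lambda>j. peval to_ac (F j) v)))"

definition regular_map2 ::
  "('n::finite, 'k::field alg_closure) proj_point set
   \<Rightarrow> ('n'::finite, 'k alg_closure) proj_point set
   \<Rightarrow> (('n, 'k alg_closure) proj_point \<Rightarrow> ('n', 'k alg_closure) proj_point
        \<Rightarrow> ('m, 'k alg_closure) proj_point) \<Rightarrow> bool" where
  "regular_map2 V W f \<longleftrightarrow> (\<forall>P\<in>V. \<forall>Q\<in>W. \<exists>d e. \<exists>F :: 'm \<Rightarrow> ('n + 'n' \<Rightarrow>\<^sub>0 nat) \<Rightarrow>\<^sub>0 'k.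
     (\<forall>j. bihomogeneous d e (F j))
     \<and> (\<forall>v\<in>P. \<forall>w\<in>Q. \<exists>j. peval to_ac (F j) (case_sum v w) \<noteq> 0)
     \<and> (\<forall>P'\<in>V. \<forall>Q'\<in>W. \<forall>v\<in>P'. \<forall>w\<in>Q'. (\<exists>j. peval to_ac (F j) (case_sum v w) \<noteq> 0)
          \<longrightarrow> f P' Q' = proj_point (\<lambda>j. peval to_ac (F j) (case_sum v w))))"

definition rational_point :: "('n, 'k::field alg_closure) proj_point \<Rightarrow> bool" where
  "rational_point P \<longleftrightarrow> (\<exists>v :: 'n \<Rightarrow> 'k. v \<noteq> (\<lambda>_. 0) \<and> P = proj_point (\<lambda>i. to_ac (v i)))"

text \<open>
  An abelian variety over \<open>'k\<close> is a projective commutative group variety over \<open>'k\<close>, given by the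
  group of its points over the algebraic closure. The group is written multiplicatively.
\<close>

locale abelian_variety = comm_group A
  for A :: "('n::finite, 'k::{field,finite} alg_closure) proj_point monoid" (structure) +
  assumes variety: "projective_variety (carrier A)"
    and mult_regular: "regular_map2 (carrier A) (carrier A) (\<lambda>P Q. P \<otimes> Q)"
    and inv_regular: "regular_map (carrier A) (\<lambda>P. inv P)"
    and one_rational: "rational_point \<one>"

definition torsion_group :: "('a, 'b) monoid_scheme \<Rightarrow> nat \<Rightarrow> ('a, 'b) monoid_scheme" where
  "torsion_group G n = G\<lparr>carrier := {x \<in> carrier G. x [^]\<^bsub>G\<^esub> n = \<one>\<^bsub>G\<^esub>}\<rparr>"

text \<open>
  The \<open>q\<close>-power Frobenius. The image of a point is a full set of homogeneous coordinates, since
  every scalar in the algebraic closure is a \<open>q\<close>-th power.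
\<close>

definition frobenius ::
  "('n, 'k::{field,finite} alg_closure) proj_point \<Rightarrow> ('n, 'k alg_closure) proj_point" where
  "frobenius P = (\<lambda>v i. v i ^ CARD('k)) ` P"

definition torsion_quandle ::
  "('n, 'k::{field,finite} alg_closure) proj_point monoid \<Rightarrow> nat
   \<Rightarrow> ('n, 'k alg_closure) proj_point quandle_struct" where
  "torsion_quandle A l = alexander_quandle (torsion_group A l) frobenius"

definition coloring_primes ::
  "('n, 'k::{field,finite} alg_closure) proj_point monoid \<Rightarrow> knot \<Rightarrow> nat set" where
  "coloring_primes A K = {l. prime l \<and> l \<noteq> CHAR('k)
     \<and> (\<exists>f. nonconstant_coloring K (torsion_quandle A l) f)}"

definition persistently_colorable ::
  "('n, 'k::{field,finite} alg_closure) proj_point monoid \<Rightarrow> knot \<Rightarrow> bool" where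
  "persistently_colorable A K \<longleftrightarrow> infinite (coloring_primes A K)"

end

theory Submission
  imports Defs
begin

text \<open>
  For a fixed prime, nonconstant colorings of the sum \<open>w\<^sub>1 @ w\<^sub>2\<close> exist iff they exist for \<open>w\<^sub>1\<close> or
  \<open>w\<^sub>2\<close>. A coloring of one summand extends by a constant on the other one. Conversely, a coloring of
  the sum restricts to colorings of the summands as soon as the two ends of \<open>w\<^sub>1\<close>, cut open at the
  base point, have the same color. This depends on planarity: as the code has two more faces than
  crossings, linear algebra gives an Alexander numbering of the faces, and the relations at the
  crossings of an Alexander coloring, weighted by the powers of the Frobenius that the numbering prescribes,
  add up to the equality of the two end colors. Invariance under the Reidemeister moves makes the
  choice of diagrams irrelevant. The torsion quandle is a quandle since the Frobenius, which
  commutes with polynomials over the finite field, is an automorphism of the group of points.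
\<close>

section \<open>Alexander numberings of planar diagrams\<close>

text \<open>For codes that are not planar the end colors can differ. The well-formed code
  \<open>[Over 1 True, Under 2 True, Under 1 True, Over 2 True]\<close>, the virtual trefoil, shows
  it: cut at the base point and colored by an Alexander quandle, it only requires that the
  difference \<open>d\<close> of the end colors satisfy
  \<open>\<phi> (\<phi> d) - \<phi> d + d = 0\<close> (written additively). Geometrically, the
  Alexander number of a face is the winding number of the projection around it. A code offers no
  plane in which to measure it; what \<open>planar\<close> supplies is a number of faces, so the
  numbering has to come from comparing the numbers of unknowns and equations. Colorings are handled
  as a base color together with colors of upper strands indexed by crossings: a Reidemeister move
  then edits a word and affects at most two of these colors, whereas arcs are sets of positions,
  which a move renumbers.\<close>

lemma homogeneous_system_nontrivial_solution:
  fixes A :: "'e \<Rightarrow> 'u \<Rightarrow> 'a::field"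
  assumes "finite E" "finite U" "card E < card U"
  shows "\<exists>N. (\<forall>e\<in>E. (\<Sum>u\<in>U. A e u * N u) = 0) \<and> (\<exists>u\<in>U. N u \<noteq> 0)"
  using assms
proof (induction E arbitrary: U A rule: finite_induct)
  case empty
  then have "U \<noteq> {}" by auto
  then show ?case by (auto intro!: exI[of _ "\<lambda>_. 1"])
next
  case (insert e E)
  show ?case
  proof (cases "\<exists>p\<in>U. A e p \<noteq> 0")
    case False
    obtain N where "\<forall>e\<in>E. (\<Sum>u\<in>U. A e u * N u) = 0" "\<exists>u\<in>U. N u \<noteq> 0"
      using insert.IH[of U A] insert.prems insert.hyps by auto
    moreover have "(\<Sum>u\<in>U. A e u * N u) = 0"
      using False by simp
    ultimately show ?thesis by auto
  next
    case True
    then obtain p where p: "p \<in> U" "A e p \<noteq> 0" by blast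
    \<comment> \<open>Gaussian elimination with pivot \<open>A e p\<close>: subtracting a multiple
      of equation \<open>e\<close> removes the unknown \<open>p\<close> from equation
      \<open>e'\<close>.\<close>
    let ?B = "\<lambda>e' u. A e' u - A e' p * A e u / A e p"
    have "card E < card (U - {p})"
      using insert.prems insert.hyps p by simp
    then obtain N where N: "\<forall>e'\<in>E. (\<Sum>u\<in>U - {p}. ?B e' u * N u) = 0" "\<exists>u\<in>U - {p}. N u \<noteq> 0"
      using insert.IH[of "U - {p}" ?B] insert.prems by auto
    \<comment> \<open>The value of the pivot unknown for which equation \<open>e\<close>
      holds.\<close>
    define t where "t = - (\<Sum>u\<in>U - {p}. A e u * N u) / A e p"
    have split: "(\<Sum>u\<in>U. A e' u * (N(p := t)) u) = A e' p * t + (\<Sum>u\<in>U - {p}. A e' u * N u)" for e'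
    proof -
      have "(\<Sum>u\<in>U - {p}. A e' u * (N(p := t)) u) = (\<Sum>u\<in>U - {p}. A e' u * N u)"
        by (rule sum.cong) auto
      then show ?thesis
        using insert.prems(1) p(1) by (simp add: sum.remove[of U p])
    qed
    have "(\<Sum>u\<in>U. A e' u * (N(p := t)) u) = 0" if "e' \<in> E" for e'
    proof -
      have "0 = (\<Sum>u\<in>U - {p}. A e' u * N u - A e' p / A e p * (A e u * N u))"
        using N(1) that by (simp add: algebra_simps)
      also have "\<dots> = (\<Sum>u\<in>U - {p}. A e' u * N u) - A e' p / A e p * (\<Sum>u\<in>U - {p}. A e u * N u)"
        by (simp add: sum_subtractf sum_distrib_left)
      finally show ?thesis
        unfolding split using p(2) by (simp add: t_def field_simps)
    qed
    moreover have "(\<Sum>u\<in>U. A e u * (N(p := t)) u) = 0"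
      unfolding split using p(2) by (simp add: t_def)
    moreover have "\<exists>u\<in>U. (N(p := t)) u \<noteq> 0"
      using N(2) by auto
    ultimately show ?thesis by (intro exI[of _ "N(p := t)"]) auto
  qed
qed

section \<open>Well-formed codes: partners and neighboring edges\<close>

lemma wf_gauss_code_distinct: "wf_gauss_code w \<Longrightarrow> distinct w"
  by (simp add: wf_gauss_code_def)

lemma wf_gauss_code_passages:
  assumes "wf_gauss_code w" "p \<in> set w"
  shows "Over (crossing p) (positive p) \<in> set w" "Under (crossing p) (positive p) \<in> set w"
proof -
  have "Over c s \<in> set w \<longleftrightarrow> Under c s \<in> set w" for c s
    using assms(1) by (simp add: wf_gauss_code_def)
  then show "Over (crossing p) (positive p) \<in> set w" "Under (crossing p) (positive p) \<in> set w"
    using assms(2) by (cases p; auto)+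
qed

lemma wf_gauss_code_sign:
  assumes "wf_gauss_code w" "p \<in> set w" "q \<in> set w" "crossing p = crossing q"
  shows "positive p = positive q"
proof -
  have "\<not> (Over (crossing p) True \<in> set w \<and> Over (crossing p) False \<in> set w)"
    using assms(1) unfolding wf_gauss_code_def by blast
  then show ?thesis
    using wf_gauss_code_passages(1)[OF assms(1,2)] wf_gauss_code_passages(1)[OF assms(1,3)] assms(4)
    by (cases "positive p"; cases "positive q") auto
qed

lemma partner:
  assumes "wf_gauss_code w" "i < length w"
  shows "partner w i < length w" "w ! partner w i = other_passage (w ! i)"
proof -
  have "other_passage (w ! i) \<in> set w"
    using wf_gauss_code_passages[OF assms(1) nth_mem[OF assms(2)]] by (cases "w ! i") auto
  then obtain j where "j < length w" "w ! j = other_passage (w ! i)"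
    unfolding in_set_conv_nth by blast
  then have "\<exists>!j. j < length w \<and> w ! j = other_passage (w ! i)"
    using nth_eq_iff_index_eq[OF wf_gauss_code_distinct[OF assms(1)]]
    by (intro ex1I[of _ j]) (simp, metis)
  from theI'[OF this] show "partner w i < length w" "w ! partner w i = other_passage (w ! i)"
    unfolding partner_def by auto
qed

lemma partner_eqI:
  assumes "wf_gauss_code w" "j < length w" "w ! j = other_passage (w ! i)"
  shows "partner w i = j"
  unfolding partner_def
proof (rule the_equality)
  have "distinct w" using assms(1) by (simp add: wf_gauss_code_def)
  then show "k = j" if "k < length w \<and> w ! k = other_passage (w ! i)" for k
    using that assms(2,3) nth_eq_iff_index_eq[of w k j] by simp
qed (use assms in simp)

lemma other_passage_other [simp]: "other_passage (other_passage p) = p"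
  by (cases p) auto

lemma partner_partner:
  assumes "wf_gauss_code w" "i < length w"
  shows "partner w (partner w i) = i"
  using assms partner[OF assms] by (intro partner_eqI) auto

lemma crossed_leftwards_partner:
  assumes "wf_gauss_code w" "i < length w"
  shows "crossed_leftwards w (partner w i) \<longleftrightarrow> \<not> crossed_leftwards w i"
  using partner(2)[OF assms] by (cases "w ! i") (auto simp: crossed_leftwards_def)

lemma next_edge_less: "i < length w \<Longrightarrow> next_edge w i < length w"
  unfolding next_edge_def by (rule mod_less_divisor) linarith

lemma prev_edge_less: "i < length w \<Longrightarrow> prev_edge w i < length w"
  unfolding prev_edge_def by (rule mod_less_divisor) linarith

lemma prev_next_edge: "i < length w \<Longrightarrow> prev_edge w (next_edge w i) = i"
  by (cases "Suc i = length w") (auto simp: prev_edge_def next_edge_def)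

lemma next_prev_edge: "i < length w \<Longrightarrow> next_edge w (prev_edge w i) = i"
  by (cases i) (auto simp: prev_edge_def next_edge_def)

section \<open>Faces as cycles of directed edges\<close>

definition face_of :: "gauss_code \<Rightarrow> nat \<times> bool \<Rightarrow> (nat \<times> bool) set" where
  "face_of w d = {(face_step w ^^ n) d | n. True}"

lemma faces_face_of: "w \<noteq> [] \<Longrightarrow> faces w = face_of w ` ({..<length w} \<times> UNIV)"
  by (auto simp: faces_def face_of_def edges_def max_def)

text \<open>The preimage of a directed edge depends on which way the strands cross at its start. As
  the set is finite, surjectivity makes \<open>face_step\<close> a permutation of the directed
  edges.\<close>

lemma face_step_image:
  assumes "wf_gauss_code w"
  shows "face_step w ` ({..<length w} \<times> UNIV) = {..<length w} \<times> UNIV" (is "_ ` ?D = _")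
proof
  show "face_step w ` ?D \<subseteq> ?D"
  proof (rule image_subsetI)
    fix d assume "d \<in> ?D"
    then obtain i b where "d = (i, b)" "i < length w" by (cases d) auto
    then show "face_step w d \<in> ?D"
      using assms by (cases b) (auto simp: Let_def next_edge_less prev_edge_less partner)
  qed
  show "?D \<subseteq> face_step w ` ?D"
  proof
    fix d assume "d \<in> ?D"
    then obtain m b where d: "d = (m, b)" "m < length w" by (cases d) auto
    show "d \<in> face_step w ` ?D"
    proof (cases b)
      case True
      define k where "k = partner w (prev_edge w m)"
      have k: "k < length w" "partner w k = prev_edge w m"
        using assms d by (auto simp: k_def partner prev_edge_less partner_partner)
      show ?thesis
      proof (cases "crossed_leftwards w k")
        case True
        then have "face_step w (k, True) = d"
          using d k \<open>b\<close> by (simp add: Let_def next_prev_edge)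
        then show ?thesis using k(1) by (intro image_eqI[of _ _ "(k, True)"]) auto
      next
        case False
        then have "face_step w (next_edge w k, False) = d"
          using d k \<open>b\<close> by (simp add: Let_def next_prev_edge prev_next_edge)
        then show ?thesis
          using next_edge_less[OF k(1)] by (intro image_eqI[of _ _ "(next_edge w k, False)"]) auto
      qed
    next
      case False
      define k where "k = partner w m"
      have k: "k < length w" "partner w k = m"
        using assms d by (auto simp: k_def partner partner_partner)
      show ?thesis
      proof (cases "crossed_leftwards w k")
        case True
        then have "face_step w (next_edge w k, False) = d"
          using d k \<open>\<not> b\<close> by (simp add: Let_def prev_next_edge)
        then show ?thesis
          using next_edge_less[OF k(1)] by (intro image_eqI[of _ _ "(next_edge w k, False)"]) auto
      next
        case False
        then have "face_step w (k, True) = d"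
          using d k \<open>\<not> b\<close> by (simp add: Let_def)
        then show ?thesis using k(1) by (intro image_eqI[of _ _ "(k, True)"]) auto
      qed
    qed
  qed
qed

text \<open>\<open>face_of\<close> collects forward iterates only. The injective
  \<open>face_step\<close> maps the finite orbit onto itself, and the image of the orbit is the
  orbit of the next directed edge.\<close>

lemma face_of_face_step:
  assumes wf: "wf_gauss_code w" and d: "d \<in> {..<length w} \<times> UNIV"
  shows "face_of w (face_step w d) = face_of w d"
proof -
  let ?D = "{..<length w} \<times> (UNIV :: bool set)" and ?f = "face_step w"
  have mem: "(?f ^^ n) d \<in> ?D" for n
  proof (induction n)
    case (Suc n)
    then have "?f ((?f ^^ n) d) \<in> ?f ` ?D" by (rule imageI)
    then show ?case using face_step_image[OF wf] by simp
  qed (use d in simp)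
  then have sub: "face_of w d \<subseteq> ?D" unfolding face_of_def by blast
  have "inj_on ?f ?D"
    by (rule eq_card_imp_inj_on) (auto simp: face_step_image[OF wf])
  then have inj: "inj_on ?f (face_of w d)" using sub by (rule inj_on_subset)
  have step: "?f ((?f ^^ n) d) = (?f ^^ Suc n) d" for n by simp
  have "?f ` face_of w d \<subseteq> face_of w d"
    unfolding face_of_def using step by blast
  then have "?f ` face_of w d = face_of w d"
    using inj finite_subset[OF sub] by (intro endo_inj_surj) auto
  moreover have "?f ` face_of w d = face_of w (?f d)"
  proof -
    have range: "face_of w x = range (\<lambda>n. (?f ^^ n) x)" for x unfolding face_of_def by blast
    have "(\<lambda>n. ?f ((?f ^^ n) d)) = (\<lambda>n. (?f ^^ n) (?f d))"
      by (rule ext) (rule funpow_swap1)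
    then show ?thesis unfolding range image_image by (rule arg_cong)
  qed
  ultimately show ?thesis by simp
qed

lemma card_over_passages:
  assumes "wf_gauss_code w"
  shows "card {i. i < length w \<and> is_over (w ! i)} = card (crossings w)"
proof (rule bij_betw_same_card[of "\<lambda>i. crossing (w ! i)"], unfold bij_betw_def, intro conjI)
  let ?Ov = "{i. i < length w \<and> is_over (w ! i)}"
  show "inj_on (\<lambda>i. crossing (w ! i)) ?Ov"
  proof (rule inj_onI)
    fix i j assume ij: "i \<in> ?Ov" "j \<in> ?Ov" and eq: "crossing (w ! i) = crossing (w ! j)"
    have "positive (w ! i) = positive (w ! j)"
      using wf_gauss_code_sign[OF assms] ij eq by simp
    then have "w ! i = w ! j"
      using ij eq by (cases "w ! i"; cases "w ! j") auto
    then show "i = j"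
      using ij nth_eq_iff_index_eq[OF wf_gauss_code_distinct[OF assms]] by auto
  qed
  show "(\<lambda>i. crossing (w ! i)) ` ?Ov = crossings w"
  proof
    show "(\<lambda>i. crossing (w ! i)) ` ?Ov \<subseteq> crossings w" by (auto simp: crossings_def)
    show "crossings w \<subseteq> (\<lambda>i. crossing (w ! i)) ` ?Ov"
    proof
      fix c assume "c \<in> crossings w"
      then obtain p where p: "p \<in> set w" "c = crossing p" by (auto simp: crossings_def)
      then have "Over c (positive p) \<in> set w" using wf_gauss_code_passages[OF assms] by simp
      then obtain i where "i < length w" "w ! i = Over c (positive p)" by (auto simp: in_set_conv_nth)
      then show "c \<in> (\<lambda>i. crossing (w ! i)) ` ?Ov" by force
    qed
  qed
qed

text \<open>A knot has a single component: following the orientation from edge 0 reaches every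
  edge.\<close>

lemma nat_next_edge_induct:
  assumes "i < length w" "P 0" "\<And>i. i < length w \<Longrightarrow> P i \<Longrightarrow> P (next_edge w i)"
  shows "P i"
  using assms(1)
proof (induction i)
  case (Suc i)
  then show ?case using assms(3)[of i] by (simp add: next_edge_def)
qed (use assms in auto)

text \<open>
  Let \<open>n\<close> be the number of crossings. A labelling of the \<open>n + 2\<close> faces that vanishes at one face and
  jumps by the same amount across the two edges at every over-passage is a solution of \<open>n + 1\<close> linear
  equations. In a nonzero solution the jump is the same nonzero \<open>k\<close> across all edges, and \<open>L i\<close> is the
  label to the left of edge \<open>i\<close> divided by \<open>k\<close>.
\<close>

lemma alexander_numbering_rat:
  assumes "knot_diagram w" "w \<noteq> []"
  shows "\<exists>L :: nat \<Rightarrow> rat. \<forall>i<length w.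
    L (next_edge w i) = L i + (if crossed_leftwards w i then - 1 else 1) \<and>
    (crossed_leftwards w i \<longrightarrow> L (partner w i) = L i - 1)"
proof -
  have wf: "wf_gauss_code w" and planar: "card (faces w) = card (crossings w) + 2"
    using assms by (auto simp: knot_diagram_def planar_def)
  define n where "n = length w"
  let ?F = "face_of w"
  let ?D = "{..<n} \<times> (UNIV :: bool set)"
  have n: "0 < n" using assms(2) by (simp add: n_def)
  have fin: "finite (faces w)" using faces_face_of[OF assms(2)] by simp
  have F: "?F (i, b) \<in> faces w" if "i < n" for i b
    using that faces_face_of[OF assms(2)] by (auto simp: n_def)
  define Ov where "Ov = {i. i < n \<and> is_over (w ! i)}"
  have Ov: "finite (insert n Ov)" "card (insert n Ov) = card (crossings w) + 1"
    using card_over_passages[OF wf] by (auto simp: Ov_def n_def)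
  define ind :: "(nat \<times> bool) set \<Rightarrow> (nat \<times> bool) set \<Rightarrow> rat" where
    "ind f u = (if f = u then 1 else 0)" for f u
  \<comment> \<open>Row \<open>n\<close>, which is not the index of a passage, fixes the label to
    the left of edge 0 and so excludes nonzero constant solutions. Sums of indicators let
    coefficients accumulate when several sides belong to one face.\<close>
  define A where "A i u = (if i = n then ind (?F (0, True)) u else
     ind (?F (next_edge w i, True)) u - ind (?F (next_edge w i, False)) u
     - ind (?F (i, True)) u + ind (?F (i, False)) u)" for i u
  have "\<exists>N. (\<forall>e\<in>insert n Ov. (\<Sum>u\<in>faces w. A e u * N u) = 0) \<and> (\<exists>u\<in>faces w. N u \<noteq> 0)"
    by (rule homogeneous_system_nontrivial_solution) (use Ov fin planar in auto)
  then obtain N where N: "\<And>e. e \<in> insert n Ov \<Longrightarrow> (\<Sum>u\<in>faces w. A e u * N u) = 0"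
    and N0: "\<exists>u\<in>faces w. N u \<noteq> 0" by blast
  have ind: "(\<Sum>u\<in>faces w. ind f u * N u) = N f" if "f \<in> faces w" for f
    using that fin by (simp add: ind_def if_distrib[of "\<lambda>x. x * _"] cong: if_cong)
  define l where "l i = N (?F (i, True))" for i
  define r where "r i = N (?F (i, False))" for i
  have l0: "l 0 = 0"
    using N[of n] ind[OF F[OF n]] by (simp add: A_def l_def)
  have eqOv: "l (next_edge w i) - r (next_edge w i) = l i - r i" if "i \<in> Ov" for i
  proof -
    have i: "i < n" "next_edge w i < n" using that next_edge_less[of i w] by (auto simp: Ov_def n_def)
    have "0 = (\<Sum>u\<in>faces w. A i u * N u)" using N that by auto
    also have "\<dots> = (\<Sum>u\<in>faces w. ind (?F (next_edge w i, True)) u * N u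
        - ind (?F (next_edge w i, False)) u * N u - ind (?F (i, True)) u * N u + ind (?F (i, False)) u * N u)"
    proof (rule sum.cong[OF HOL.refl])
      fix u
      have "i \<noteq> n" using i by simp
      then show "A i u * N u = ind (?F (next_edge w i, True)) u * N u
        - ind (?F (next_edge w i, False)) u * N u - ind (?F (i, True)) u * N u + ind (?F (i, False)) u * N u"
        unfolding A_def by (simp only: if_False left_diff_distrib distrib_right)
    qed
    also have "\<dots> = l (next_edge w i) - r (next_edge w i) - l i + r i"
      unfolding sum.distrib sum_subtractf l_def r_def using i by (simp only: ind F)
    finally show ?thesis by simp
  qed
  have step: "N (?F (face_step w (i, b))) = N (?F (i, b))" if "i < n" for i b
    using face_of_face_step[OF wf, of "(i, b)"] that by (simp add: n_def)
  \<comment> \<open>One equation for each of the four corners of the crossing: the two directed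
    edges along a corner are joined by \<open>face_step\<close>, so they bound the same
    face.\<close>
  have cross: "l (next_edge w (partner w i)) = l i" "l (partner w i) = r i"
    "r (next_edge w i) = r (partner w i)" "r (next_edge w (partner w i)) = l (next_edge w i)"
    if i: "i < n" and cl: "crossed_leftwards w i" for i
  proof -
    define j where "j = partner w i"
    have j: "j < n" "partner w j = i" "\<not> crossed_leftwards w j"
      using wf i cl by (auto simp: j_def partner n_def partner_partner crossed_leftwards_partner)
    have less: "next_edge w i < n" "next_edge w j < n"
      using next_edge_less i j by (auto simp: n_def)
    have prev: "prev_edge w (next_edge w i) = i" "prev_edge w (next_edge w j) = j"
      using prev_next_edge i j by (auto simp: n_def)
    show "l (next_edge w (partner w i)) = l i" "l (partner w i) = r i"
      "r (next_edge w i) = r (partner w i)" "r (next_edge w (partner w i)) = l (next_edge w i)"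
      using step[OF i, of True] step[OF j(1), of True] step[OF less(1), of False]
        step[OF less(2), of False] cl j prev
      by (simp_all add: l_def r_def Let_def flip: j_def)
  qed
  \<comment> \<open>Only over-passages have an equation. By the corner identities, the change of the
    jump along one strand of a crossing is, up to sign, its change along the other.\<close>
  have jump: "l (next_edge w i) - r (next_edge w i) = l i - r i" if i: "i < n" for i
  proof (cases "is_over (w ! i)")
    case True
    then show ?thesis using eqOv i by (simp add: Ov_def)
  next
    case False
    define j where "j = partner w i"
    have j: "j < n" "partner w j = i" "crossed_leftwards w j \<longleftrightarrow> \<not> crossed_leftwards w i"
      using wf i by (auto simp: j_def partner n_def partner_partner crossed_leftwards_partner)
    have "is_over (w ! j)"
      using False partner(2)[OF wf, of i] i by (cases "w ! i") (auto simp: j_def n_def)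
    then have "j \<in> Ov" using j(1) by (simp add: Ov_def)
    then have eq: "l (next_edge w j) - r (next_edge w j) = l j - r j" by (rule eqOv)
    show ?thesis
    proof (cases "crossed_leftwards w i")
      case True
      then show ?thesis using cross[OF i True, folded j_def] eq by linarith
    next
      case False
      then have "crossed_leftwards w j" using j(3) by simp
      then show ?thesis using cross[OF j(1), unfolded j(2)] eq by linarith
    qed
  qed
  define k where "k = l 0 - r 0"
  have k: "l i - r i = k" if "i < n" for i
    using that unfolding n_def
    by (rule nat_next_edge_induct) (use jump in \<open>auto simp: k_def n_def\<close>)
  have lstep: "l (next_edge w i) = l i + (if crossed_leftwards w i then - k else k)" if i: "i < n" for i
  proof (cases "crossed_leftwards w i")
    case True
    then show ?thesis using cross[OF i] k[OF i] k[of "next_edge w i"] k[of "partner w i"]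
        next_edge_less[of i w] partner[OF wf, of i] i by (simp add: n_def)
  next
    case False
    define j where "j = partner w i"
    have j: "j < n" "partner w j = i" "crossed_leftwards w j"
      using wf i False by (auto simp: j_def partner n_def partner_partner crossed_leftwards_partner)
    show ?thesis using cross[OF j(1,3)] j k[OF j(1)] False by simp
  qed
  \<comment> \<open>Otherwise the labels along the knot are constantly \<open>l 0 = 0\<close> on
    both sides, and since every face borders an edge, the solution would be zero.\<close>
  have "k \<noteq> 0"
  proof
    assume "k = 0"
    have "l i = 0" if "i < n" for i
      using that unfolding n_def
      by (rule nat_next_edge_induct) (use lstep l0 \<open>k = 0\<close> in \<open>auto simp: n_def\<close>)
    then have "l i = 0" "r i = 0" if "i < n" for i using k[OF that] that \<open>k = 0\<close> by auto
    then have "N (?F (i, b)) = 0" if "i < n" for i b using that by (cases b) (auto simp: l_def r_def)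
    then show False using N0 faces_face_of[OF assms(2)] by (auto simp: n_def)
  qed
  show ?thesis
  proof (intro exI[of _ "\<lambda>i. l i / k"] allI impI conjI)
    fix i assume "i < length w"
    then have i: "i < n" by (simp add: n_def)
    show "l (next_edge w i) / k = l i / k + (if crossed_leftwards w i then - 1 else 1)"
      using \<open>k \<noteq> 0\<close> by (simp add: lstep[OF i] add_divide_distrib diff_divide_distrib)
    show "l (partner w i) / k = l i / k - 1" if "crossed_leftwards w i"
      
    proof -
      have "l (partner w i) = l i - k" using cross(2)[OF i that] k[OF i] by simp
      then show ?thesis using \<open>k \<noteq> 0\<close> by (simp add: diff_divide_distrib)
    qed
  qed
qed

text \<open>The rational numbering, negated and shifted so that it can serve as an exponent of an
  endomorphism. Positions run up to \<open>length w\<close> without wrapping, because the code will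
  be cut at its base point.\<close>

lemma alexander_numbering_nat:
  assumes "knot_diagram w"
  shows "\<exists>H :: nat \<Rightarrow> nat. H (length w) = H 0 \<and> (\<forall>i<length w.
    crossed_leftwards w i \<longrightarrow> H (Suc i) = Suc (H i) \<and> H (partner w i) = Suc (H i)
      \<and> H (Suc (partner w i)) = H i)"
proof (cases "w = []")
  case False
  have wf: "wf_gauss_code w" using assms by (simp add: knot_diagram_def)
  obtain L :: "nat \<Rightarrow> rat" where L: "\<And>i. i < length w \<Longrightarrow>
      L (next_edge w i) = L i + (if crossed_leftwards w i then - 1 else 1)"
    and Lp: "\<And>i. i < length w \<Longrightarrow> crossed_leftwards w i \<Longrightarrow> L (partner w i) = L i - 1"
    using alexander_numbering_rat[OF assms False] by blast
  define s :: "nat \<Rightarrow> int" where "s i = (if crossed_leftwards w i then 1 else - 1)" for i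
  \<comment> \<open>Each passage changes the sum by 1, so the offset \<open>length w\<close> keeps
    \<open>h\<close> nonnegative at all positions of the code.\<close>
  define h where "h i = int (length w) + (\<Sum>j<i. s j)" for i
  have "h i \<ge> int (length w) - int i" for i
    by (induction i) (auto simp: h_def s_def)
  then have h0: "h i \<ge> 0" if "i \<le> length w" for i
    using that by (smt (verit) of_nat_le_iff)
  have hS: "h (Suc i) = h i + s i" for i by (simp add: h_def)
  have Lh: "L (i mod length w) = L 0 + rat_of_int (h 0) - rat_of_int (h i)" if "i \<le> length w" for i
    using that
  proof (induction i)
    case (Suc i)
    then have "L (Suc i mod length w) = L i - rat_of_int (s i)"
      using L[of i] by (simp add: next_edge_def s_def)
    then show ?case using Suc by (simp add: hS)
  qed simp
  have hL: "h i = h j + d" if "L i = L j - rat_of_int d" "i < length w" "j < length w" for i j d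
  proof -
    have "rat_of_int (h i) = rat_of_int (h j + d)"
      using that Lh[of i] Lh[of j] by simp
    then show ?thesis by (simp only: of_int_eq_iff)
  qed
  show ?thesis
  proof (intro exI[of _ "\<lambda>i. nat (h i)"] conjI allI impI)
    show "nat (h (length w)) = nat (h 0)" using Lh[of "length w"] by simp
    fix i assume i: "i < length w" and cl: "crossed_leftwards w i"
    define j where "j = partner w i"
    have j: "j < length w" "\<not> crossed_leftwards w j"
      using wf i cl by (auto simp: j_def partner crossed_leftwards_partner)
    have "h (Suc i) = h i + 1" "h j = h i + 1" "h (Suc j) = h j - 1"
      using hL[of j i 1] Lp[OF i cl] i j cl by (auto simp: hS s_def j_def)
    then show "nat (h (Suc i)) = Suc (nat (h i))" "nat (h (partner w i)) = Suc (nat (h i))"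
      "nat (h (Suc (partner w i))) = nat (h i)"
      using h0[of i] i by (auto simp: j_def)
  qed
qed auto

section \<open>Colorings of Gauss codes and Reidemeister moves\<close>

context quandle
begin

text \<open>The color with which a strand of color \<open>x\<close> emerges from below a strand of
  color \<open>y\<close> at a crossing of sign \<open>s\<close>. At a negative crossing the relation
  has the outgoing color on the left of the operation, hence the inverse translation.\<close>

definition act :: "bool \<Rightarrow> 'a \<Rightarrow> 'a \<Rightarrow> 'a" where
  "act s x y = (if s then x \<triangleright> y else the_inv_into (carrier Q) (\<lambda>z. z \<triangleright> y) x)"

lemma op_closed: "x \<in> carrier Q \<Longrightarrow> y \<in> carrier Q \<Longrightarrow> x \<triangleright> y \<in> carrier Q"
  using bij bij_betwE by blast

lemma op_cancel: "x \<in> carrier Q \<Longrightarrow> y \<in> carrier Q \<Longrightarrow> z \<in> carrier Q \<Longrightarrow> x \<triangleright> z = y \<triangleright> z \<Longrightarrow> x = y"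
  using bij[of z] by (auto simp: bij_betw_def dest: inj_onD)

lemma act_closed:
  assumes "x \<in> carrier Q" "y \<in> carrier Q"
  shows "act s x y \<in> carrier Q"
proof (cases s)
  case False
  show ?thesis
    using the_inv_into_into[of "\<lambda>z. z \<triangleright> y" "carrier Q" x "carrier Q"] bij[OF assms(2)] assms False
    by (auto simp: act_def bij_betw_def)
qed (use assms in \<open>simp add: act_def op_closed\<close>)

lemma act_False_op: "x \<in> carrier Q \<Longrightarrow> y \<in> carrier Q \<Longrightarrow> act False x y \<triangleright> y = x"
  using bij[of y] f_the_inv_into_f[of "\<lambda>z. z \<triangleright> y" "carrier Q" x]
  by (simp add: act_def bij_betw_def)

lemma op_act_False: "x \<in> carrier Q \<Longrightarrow> y \<in> carrier Q \<Longrightarrow> act False (x \<triangleright> y) y = x"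
  using bij[of y] the_inv_into_f_f[of "\<lambda>z. z \<triangleright> y" "carrier Q" x]
  by (simp add: act_def bij_betw_def)

lemma act_inverse: "x \<in> carrier Q \<Longrightarrow> y \<in> carrier Q \<Longrightarrow> act (\<not> s) (act s x y) y = x"
  using act_False_op op_act_False by (cases s) (auto simp: act_def)

lemma act_inverse': "x \<in> carrier Q \<Longrightarrow> y \<in> carrier Q \<Longrightarrow> act s (act (\<not> s) x y) y = x"
  using act_inverse[of x y "\<not> s"] by simp

lemma act_idem: "x \<in> carrier Q \<Longrightarrow> act s x x = x"
  using op_act_False[of x x] idem[of x] by (cases s) (auto simp: act_def)

text \<open>In a first move this forces the color of the kink; in a third move it keeps a coloring
  nonconstant when the one affected color is replaced.\<close>

lemma act_eq_self_iff: "x \<in> carrier Q \<Longrightarrow> y \<in> carrier Q \<Longrightarrow> act s x y = y \<longleftrightarrow> x = y"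
  by (metis act_idem act_inverse)

lemma act_op_distrib:
  assumes "x \<in> carrier Q" "y \<in> carrier Q" "z \<in> carrier Q"
  shows "act s x y \<triangleright> z = act s (x \<triangleright> z) (y \<triangleright> z)"
proof (cases s)
  case True
  then show ?thesis using assms by (simp add: act_def distrib)
next
  case False
  define u where "u = act False x y"
  have u: "u \<in> carrier Q" "u \<triangleright> y = x"
    using assms by (auto simp: u_def act_closed act_False_op)
  have "x \<triangleright> z = (u \<triangleright> z) \<triangleright> (y \<triangleright> z)"
    using distrib[OF u(1) assms(2,3)] u(2) by simp
  then have "act False (x \<triangleright> z) (y \<triangleright> z) = u \<triangleright> z"
    using assms u(1) by (simp add: op_act_False op_closed)
  then show ?thesis using False by (simp add: u_def)
qed

text \<open>Translations and their inverses are quandle automorphisms, so they commute with the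
  operation and its inverse. This is the algebraic content of the third move.\<close>

lemma act_distrib:
  assumes "x \<in> carrier Q" "y \<in> carrier Q" "z \<in> carrier Q"
  shows "act r (act s x y) z = act s (act r x z) (act r y z)"
proof (cases r)
  case True
  then show ?thesis using act_op_distrib[OF assms] by (simp add: act_def[of True])
next
  case False
  let ?x = "act False x z" and ?y = "act False y z"
  have "act s ?x ?y \<triangleright> z = act s x y"
    using assms act_op_distrib[of ?x ?y z s] by (simp add: act_closed act_False_op)
  then have "act False (act s x y) z = act s ?x ?y"
    using op_act_False[of "act s ?x ?y" z] assms by (simp add: act_closed)
  then show ?thesis using False by simp
qed

text \<open>
  A coloring of a code is given by the colors \<open>g c\<close> of the upper strands and the color \<open>x\<close> of the
  edge at the base point: \<open>transport\<close> propagates \<open>x\<close> along the code, and \<open>compatible\<close> says that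
  every upper strand is met in the prescribed color.
\<close>

fun transport :: "(nat \<Rightarrow> 'a) \<Rightarrow> gauss_code \<Rightarrow> 'a \<Rightarrow> 'a" where
  "transport g [] x = x"
| "transport g (Over c s # w) x = transport g w x"
| "transport g (Under c s # w) x = transport g w (act s x (g c))"

fun compatible :: "(nat \<Rightarrow> 'a) \<Rightarrow> gauss_code \<Rightarrow> 'a \<Rightarrow> bool" where
  "compatible g [] x \<longleftrightarrow> True"
| "compatible g (Over c s # w) x \<longleftrightarrow> g c = x \<and> compatible g w x"
| "compatible g (Under c s # w) x \<longleftrightarrow> compatible g w (act s x (g c))"

definition code_coloring :: "gauss_code \<Rightarrow> (nat \<Rightarrow> 'a) \<Rightarrow> 'a \<Rightarrow> bool" where
  "code_coloring w g x \<longleftrightarrow> x \<in> carrier Q \<and> range g \<subseteq> carrier Q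
     \<and> compatible g w x \<and> transport g w x = x"

text \<open>Testing the upper strands at crossings of \<open>w\<close> is enough: if all of them
  have the base color, idempotence carries that color along the whole code. Other values of
  \<open>g\<close> mean nothing.\<close>

definition code_colorable :: "gauss_code \<Rightarrow> bool" where
  "code_colorable w \<longleftrightarrow> (\<exists>g x. code_coloring w g x \<and> (\<exists>c\<in>crossings w. g c \<noteq> x))"

lemma transport_append: "transport g (u @ v) x = transport g v (transport g u x)"
  by (induction g u x rule: transport.induct) auto

lemma compatible_append:
  "compatible g (u @ v) x \<longleftrightarrow> compatible g u x \<and> compatible g v (transport g u x)"
  by (induction g u x rule: compatible.induct) auto

lemma transport_closed:
  "x \<in> carrier Q \<Longrightarrow> range g \<subseteq> carrier Q \<Longrightarrow> transport g w x \<in> carrier Q"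
proof (induction g w x rule: transport.induct)
  case (3 g c s w x)
  then show ?case using act_closed[of x "g c" s] by auto
qed auto

lemma transport_cong:
  "(\<And>c. c \<in> crossings w \<Longrightarrow> g c = g' c) \<Longrightarrow> transport g w x = transport g' w x"
  by (induction g w x rule: transport.induct) (auto simp: crossings_def)

lemma compatible_cong:
  "(\<And>c. c \<in> crossings w \<Longrightarrow> g c = g' c) \<Longrightarrow> compatible g w x \<longleftrightarrow> compatible g' w x"
  by (induction g w x rule: compatible.induct) (auto simp: crossings_def)

lemma transport_fun_upd: "c \<notin> crossings w \<Longrightarrow> transport (g(c := y)) w x = transport g w x"
  by (rule transport_cong) auto

lemma compatible_fun_upd: "c \<notin> crossings w \<Longrightarrow> compatible (g(c := y)) w x = compatible g w x"
  by (rule compatible_cong) auto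

lemma transport_constant:
  "x \<in> carrier Q \<Longrightarrow> (\<And>c. c \<in> crossings w \<Longrightarrow> g c = x) \<Longrightarrow> transport g w x = x"
  by (induction g w x rule: transport.induct) (auto simp: crossings_def act_idem)

lemma compatible_constant:
  "x \<in> carrier Q \<Longrightarrow> (\<And>c. c \<in> crossings w \<Longrightarrow> g c = x) \<Longrightarrow> compatible g w x"
  by (induction g w x rule: compatible.induct) (auto simp: crossings_def act_idem)

lemma transport_rename: "transport g (map (rename_passage f) w) x = transport (g \<circ> f) w x"
  by (induction "g \<circ> f" w x rule: transport.induct) auto

lemma compatible_rename: "compatible g (map (rename_passage f) w) x = compatible (g \<circ> f) w x"
  by (induction "g \<circ> f" w x rule: compatible.induct) auto

end

section \<open>Invariance of colorability under the Reidemeister moves\<close>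

lemma crossings_append [simp]: "crossings (u @ v) = crossings u \<union> crossings v"
  by (auto simp: crossings_def)

lemma crossings_Nil [simp]: "crossings [] = {}"
  by (simp add: crossings_def)

lemma crossings_Cons [simp]: "crossings (p # w) = insert (crossing p) (crossings w)"
  by (simp add: crossings_def)

lemma crossings_rename: "crossings (map (rename_passage f) w) = f ` crossings w"
proof -
  have "crossing (rename_passage f p) = f (crossing p)" for p by (cases p) auto
  then show ?thesis by (simp add: crossings_def image_image)
qed

lemma crossings_ordered_pair [simp]: "crossings (ordered_pair d p q) = {crossing p, crossing q}"
  by (auto simp: ordered_pair_def crossings_def)

lemma set_ordered_pair [simp]: "set (ordered_pair d p q) = {p, q}"
  by (auto simp: ordered_pair_def)

lemma distinct_ordered_pair [simp]: "distinct (ordered_pair d p q) \<longleftrightarrow> p \<noteq> q"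
  by (auto simp: ordered_pair_def)

text \<open>A crossing is met in exactly two passages, because its sign is unique. When both lie
  outside \<open>v\<close>, the color \<open>g c\<close> can be changed without affecting
  \<open>v\<close>.\<close>

lemma wf_gauss_code_not_in_crossings:
  assumes "wf_gauss_code w" "set v \<subseteq> set w" "Over c s \<in> set w" "Over c s \<notin> set v" "Under c s \<notin> set v"
  shows "c \<notin> crossings v"
proof
  assume "c \<in> crossings v"
  then obtain q where q: "q \<in> set v" "crossing q = c" by (auto simp: crossings_def)
  then have "positive q = s"
    using wf_gauss_code_sign[OF assms(1) _ assms(3), of q] assms(2) by auto
  then have "q = Over c s \<or> q = Under c s" using q(2) by (cases q) auto
  then show False using q(1) assms(4,5) by auto
qed

context quandle
begin

lemma code_colorable_rotate:
  assumes "code_colorable (u @ v)"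
  shows "code_colorable (v @ u)"
proof -
  obtain g x c where g: "code_coloring (u @ v) g x" and c: "c \<in> crossings (u @ v)" "g c \<noteq> x"
    using assms by (auto simp: code_colorable_def)
  let ?y = "transport g u x"
  have y: "?y \<in> carrier Q" using g by (simp add: code_coloring_def transport_closed)
  have "code_coloring (v @ u) g ?y"
    using g y by (simp add: code_coloring_def transport_append compatible_append)
  \<comment> \<open>If all upper strands had the new base color, \<open>v\<close> would carry it
    unchanged to the old base point, and the old coloring would be constant too.\<close>
  moreover have "\<exists>c\<in>crossings (v @ u). g c \<noteq> ?y"
  proof (rule ccontr)
    assume "\<not> ?thesis"
    then have const: "g c = ?y" if "c \<in> crossings (v @ u)" for c using that by blast
    have "x = transport g v ?y" using g by (simp add: code_coloring_def transport_append)
    also have "\<dots> = ?y" by (rule transport_constant[OF y]) (use const in auto)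
    finally show False using const c by auto
  qed
  ultimately show ?thesis unfolding code_colorable_def by blast
qed

lemma code_colorable_rename:
  assumes inj: "inj_on f (crossings w)"
  shows "code_colorable (map (rename_passage f) w) \<longleftrightarrow> code_colorable w"
proof
  assume "code_colorable (map (rename_passage f) w)"
  then obtain g x c where g: "code_coloring (map (rename_passage f) w) g x"
    and c: "c \<in> crossings w" "g (f c) \<noteq> x"
    by (auto simp: code_colorable_def crossings_rename)
  have "code_coloring w (g \<circ> f) x"
    using g by (auto simp: code_coloring_def transport_rename compatible_rename)
  then show "code_colorable w"
    using c unfolding code_colorable_def by (metis comp_apply)
next
  assume "code_colorable w"
  then obtain g x c where g: "code_coloring w g x" and c: "c \<in> crossings w" "g c \<noteq> x"
    by (auto simp: code_colorable_def)
  let ?h = "g \<circ> inv_into (crossings w) f"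
  have eq: "(?h \<circ> f) c = g c" if "c \<in> crossings w" for c
    using inj that by simp
  have "transport (?h \<circ> f) w x = transport g w x" "compatible (?h \<circ> f) w x = compatible g w x"
    using eq by (auto intro!: transport_cong compatible_cong)
  then have "code_coloring (map (rename_passage f) w) ?h x"
    using g by (auto simp: code_coloring_def transport_rename compatible_rename)
  moreover have "\<exists>c\<in>crossings (map (rename_passage f) w). ?h c \<noteq> x"
    using c eq by (auto simp: crossings_rename)
  ultimately show "code_colorable (map (rename_passage f) w)"
    unfolding code_colorable_def by blast
qed

text \<open>The two passages of a kink are adjacent, so its upper strand has the color
  \<open>x\<close> or \<open>act s x (g a)\<close>. Both force \<open>g a = x\<close>, and the
  strand leaves the kink with the color it had.\<close>

lemma code_colorable_R1:
  assumes "wf_gauss_code (p @ w)" and p: "p = [Over a s, Under a s] \<or> p = [Under a s, Over a s]"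
  shows "code_colorable (p @ w) \<longleftrightarrow> code_colorable w"
proof -
  have a: "a \<notin> crossings w"
    by (rule wf_gauss_code_not_in_crossings[OF assms(1), where s = s])
      (use p wf_gauss_code_distinct[OF assms(1)] in auto)
  have p_col: "compatible g p x \<and> transport g p x = y \<longleftrightarrow> g a = x \<and> y = x"
    if "x \<in> carrier Q" "range g \<subseteq> carrier Q" for g x y
  proof -
    have "g a \<in> carrier Q" using that(2) by blast
    then show ?thesis
      using p that(1) act_idem[of x s] act_eq_self_iff[of x "g a" s] by auto
  qed
  have cr: "crossings (p @ w) = insert a (crossings w)" using p by auto
  show ?thesis
  proof
    assume "code_colorable (p @ w)"
    then obtain g x c where g: "code_coloring (p @ w) g x"
      and c: "c \<in> insert a (crossings w)" "g c \<noteq> x"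
      unfolding code_colorable_def cr by blast
    have "g a = x" "transport g p x = x"
      using g p_col[of x g "transport g p x"] by (auto simp: code_coloring_def compatible_append)
    then have "code_coloring w g x" "c \<in> crossings w"
      using g c by (auto simp: code_coloring_def compatible_append transport_append)
    then show "code_colorable w" using c unfolding code_colorable_def by blast
  next
    assume "code_colorable w"
    then obtain g x c where g: "code_coloring w g x" and c: "c \<in> crossings w" "g c \<noteq> x"
      by (auto simp: code_colorable_def)
    let ?g = "g(a := x)"
    have "range ?g \<subseteq> carrier Q" using g by (auto simp: code_coloring_def)
    then have "code_coloring (p @ w) ?g x"
      using g p_col[of x ?g x] a
      by (simp add: code_coloring_def compatible_append transport_append
          transport_fun_upd compatible_fun_upd)
    moreover have "c \<in> crossings (p @ w)" "?g c \<noteq> x" using c a cr by auto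
    ultimately show "code_colorable (p @ w)" unfolding code_colorable_def by blast
  qed
qed

lemma code_colorable_R2:
  assumes wf: "wf_gauss_code ([Over a s, Over b (\<not> s)] @ u @ ordered_pair d (Under a s) (Under b (\<not> s)) @ v)"
    (is "wf_gauss_code ?w")
  shows "code_colorable ?w \<longleftrightarrow> code_colorable (u @ v)"
proof -
  have a: "a \<notin> crossings (u @ v)"
    by (rule wf_gauss_code_not_in_crossings[OF wf, where s = s])
      (use wf_gauss_code_distinct[OF wf] in auto)
  have b: "b \<notin> crossings (u @ v)"
    by (rule wf_gauss_code_not_in_crossings[OF wf, where s = "\<not> s"])
      (use wf_gauss_code_distinct[OF wf] in auto)
  have cr: "crossings ?w = {a, b} \<union> crossings (u @ v)" by auto
  \<comment> \<open>Two passages of opposite sign below the same color cancel in either order, which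
    covers both orientations of the second move.\<close>
  have pair: "compatible g (ordered_pair d (Under a s) (Under b (\<not> s))) y"
    "transport g (ordered_pair d (Under a s) (Under b (\<not> s))) y = y"
    if "g a = x" "g b = x" "x \<in> carrier Q" "y \<in> carrier Q" for g x y
    using that by (auto simp: ordered_pair_def act_inverse act_inverse')
  have iff: "code_coloring ?w g x \<longleftrightarrow> code_coloring (u @ v) g x"
    if "g a = x" "g b = x" for g x
    using that pair[of g x "transport g u x"] transport_closed[of x g u]
    by (auto simp: code_coloring_def compatible_append transport_append)
  show ?thesis
  proof
    assume "code_colorable ?w"
    then obtain g x c where g: "code_coloring ?w g x" and c: "c \<in> crossings ?w" "g c \<noteq> x"
      unfolding code_colorable_def by blast
    have ab: "g a = x" "g b = x" using g by (auto simp: code_coloring_def)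
    then have "c \<in> crossings (u @ v)" using c unfolding cr by auto
    then show "code_colorable (u @ v)"
      using g iff[OF ab] c unfolding code_colorable_def by blast
  next
    assume "code_colorable (u @ v)"
    then obtain g x c where g: "code_coloring (u @ v) g x" and c: "c \<in> crossings (u @ v)" "g c \<noteq> x"
      unfolding code_colorable_def by blast
    let ?g = "g(a := x, b := x)"
    have "range ?g \<subseteq> carrier Q" using g by (auto simp: code_coloring_def)
    then have "code_coloring (u @ v) ?g x"
      using g a b
      by (simp add: code_coloring_def compatible_append transport_append
          transport_fun_upd compatible_fun_upd)
    then have "code_coloring ?w ?g x" using iff[of ?g x] by simp
    moreover have "c \<in> crossings ?w" "?g c \<noteq> x" using c a b cr by auto
    ultimately show "code_colorable ?w" unfolding code_colorable_def by blast
  qed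
qed

text \<open>
  In a third move only the color of the over-arc at \<open>c\<close> changes: that arc is the middle strand
  before or after it passes under the top strand.
\<close>

lemma R3_bottom_strand:
  assumes "(s = t) = (dM = dB)" "x \<in> carrier Q" "m \<in> carrier Q" "y \<in> carrier Q"
    and "g a = x" "g b = x" "g' a = x" "g' b = x"
    and "g c = (if dM then act s m x else m)" "g' c = (if dM then m else act s m x)"
  shows "transport g (ordered_pair dB (Under b t) (Under c r)) y
    = transport g' (ordered_pair (\<not> dB) (Under b t) (Under c r)) y"
  using assms act_distrib[of y m x t r] act_distrib[of y "act s m x" x t r]
    act_inverse[of m x s] act_closed[of m x s]
  by (cases dB; cases dM; cases "s = t") (auto simp: ordered_pair_def)

lemma R3_middle_strand:
  assumes "g a = x"
  shows "compatible g (ordered_pair d (Under a s) (Over c r)) m \<longleftrightarrow> g c = (if d then act s m x else m)"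
    "transport g (ordered_pair d (Under a s) (Over c r)) m = act s m x"
  using assms by (auto simp: ordered_pair_def)

lemma R3_top_strand:
  "compatible g (ordered_pair d (Over a s) (Over b t)) x \<longleftrightarrow> g a = x \<and> g b = x"
  "transport g (ordered_pair d (Over a s) (Over b t)) x = x"
  by (auto simp: ordered_pair_def)

lemma R3_bottom_compatible: "compatible g (ordered_pair d (Under b t) (Under c r)) y"
  by (auto simp: ordered_pair_def)

text \<open>One direction suffices: the reverse move has the same form with \<open>dT\<close>,
  \<open>dM\<close> and \<open>dB\<close> negated, which preserves \<open>sgn\<close>. The
  disjunction covers both cyclic orders of the strands.\<close>

lemma code_colorable_R3:
  assumes wf: "wf_gauss_code w" and wf': "wf_gauss_code w'"
    and sgn: "(s = t) = (dM = dB)"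
    and w: "w = ordered_pair dT (Over a s) (Over b t) @ u @ ordered_pair dM (Under a s) (Over c r) @ v
      @ ordered_pair dB (Under b t) (Under c r) @ z \<and>
      w' = ordered_pair (\<not> dT) (Over a s) (Over b t) @ u @ ordered_pair (\<not> dM) (Under a s) (Over c r) @ v
      @ ordered_pair (\<not> dB) (Under b t) (Under c r) @ z \<or>
      w = ordered_pair dT (Over a s) (Over b t) @ u @ ordered_pair dB (Under b t) (Under c r) @ v
      @ ordered_pair dM (Under a s) (Over c r) @ z \<and>
      w' = ordered_pair (\<not> dT) (Over a s) (Over b t) @ u @ ordered_pair (\<not> dB) (Under b t) (Under c r) @ v
      @ ordered_pair (\<not> dM) (Under a s) (Over c r) @ z"
    and col: "code_colorable w"
  shows "code_colorable w'"
proof -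
  have c: "c \<notin> crossings (u @ v @ z)"
    by (rule wf_gauss_code_not_in_crossings[OF wf, where s = r])
      (use wf_gauss_code_distinct[OF wf] w in auto)
  have in_w: "Over a s \<in> set w" "Over b t \<in> set w" "Over c r \<in> set w"
    using w by auto
  have "Over a s \<noteq> Over c r" "Over b t \<noteq> Over c r"
    using wf_gauss_code_distinct[OF wf] w by auto
  then have ne: "a \<noteq> c" "b \<noteq> c"
    using wf_gauss_code_sign[OF wf in_w(1,3)] wf_gauss_code_sign[OF wf in_w(2,3)] by auto
  obtain g x e where g: "code_coloring w g x" and e: "e \<in> crossings w" "g e \<noteq> x"
    using col by (auto simp: code_colorable_def)
  have x: "x \<in> carrier Q" and range_g: "range g \<subseteq> carrier Q"
    using g by (auto simp: code_coloring_def)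
  have ab: "g a = x" "g b = x"
    using g w by (auto simp: code_coloring_def compatible_append R3_top_strand)
  have "\<exists>m\<in>carrier Q. g c = (if dM then act s m x else m) \<and>
    code_coloring w' (g(c := if dM then m else act s m x)) x"
    using w
  proof (elim disjE conjE)
    assume w: "w = ordered_pair dT (Over a s) (Over b t) @ u @ ordered_pair dM (Under a s) (Over c r) @ v
      @ ordered_pair dB (Under b t) (Under c r) @ z"
    assume w': "w' = ordered_pair (\<not> dT) (Over a s) (Over b t) @ u @ ordered_pair (\<not> dM) (Under a s) (Over c r) @ v
      @ ordered_pair (\<not> dB) (Under b t) (Under c r) @ z"
    define m where "m = transport g u x"
    define g' where "g' = g(c := if dM then m else act s m x)"
    have m: "m \<in> carrier Q" using x range_g by (simp add: m_def transport_closed)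
    have gc: "g c = (if dM then act s m x else m)"
      using g ab by (simp add: w code_coloring_def compatible_append transport_append R3_top_strand
          R3_middle_strand m_def)
    have ab': "g' a = x" "g' b = x" using ab ne by (auto simp: g'_def)
    have gc': "g' c = (if dM then m else act s m x)" by (simp add: g'_def)
    have range_g': "range g' \<subseteq> carrier Q"
      using range_g m x act_closed[of m x s] by (auto simp: g'_def)
    have eq: "transport g' k = transport g k" "compatible g' k = compatible g k"
      if "c \<notin> crossings k" for k
      using that by (auto simp: g'_def transport_fun_upd compatible_fun_upd)
    define y where "y = transport g v (act s m x)"
    have y: "y \<in> carrier Q" using m x range_g by (simp add: y_def transport_closed act_closed)
    note bottom = R3_bottom_strand[OF sgn x m y ab ab' gc gc']
    have "code_coloring w' g' x"
      using g x range_g' c ab ab' gc' bottom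
      by (simp add: w w' code_coloring_def compatible_append transport_append R3_top_strand
          R3_middle_strand R3_bottom_compatible eq flip: m_def y_def)
    then show ?thesis using m gc unfolding g'_def by blast
  next
    assume w: "w = ordered_pair dT (Over a s) (Over b t) @ u @ ordered_pair dB (Under b t) (Under c r) @ v
      @ ordered_pair dM (Under a s) (Over c r) @ z"
    assume w': "w' = ordered_pair (\<not> dT) (Over a s) (Over b t) @ u @ ordered_pair (\<not> dB) (Under b t) (Under c r) @ v
      @ ordered_pair (\<not> dM) (Under a s) (Over c r) @ z"
    define y where "y = transport g u x"
    have y: "y \<in> carrier Q" using x range_g by (simp add: y_def transport_closed)
    \<comment> \<open>Here the bottom strand precedes the middle one, so \<open>m\<close> depends on
      the color \<open>y'\<close> with which the bottom strand leaves; \<open>bottom'\<close> shows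
      that the move preserves it.\<close>
    define y' where "y' = transport g (ordered_pair dB (Under b t) (Under c r)) y"
    define m where "m = transport g v y'"
    define g' where "g' = g(c := if dM then m else act s m x)"
    have m: "m \<in> carrier Q" using y range_g by (simp add: m_def y'_def transport_closed)
    have gc: "g c = (if dM then act s m x else m)"
      using g ab by (simp add: w code_coloring_def compatible_append transport_append R3_top_strand
          R3_middle_strand m_def y_def y'_def)
    have ab': "g' a = x" "g' b = x" using ab ne by (auto simp: g'_def)
    have gc': "g' c = (if dM then m else act s m x)" by (simp add: g'_def)
    have range_g': "range g' \<subseteq> carrier Q"
      using range_g m x act_closed[of m x s] by (auto simp: g'_def)
    have eq: "transport g' k = transport g k" "compatible g' k = compatible g k"
      if "c \<notin> crossings k" for k
      using that by (auto simp: g'_def transport_fun_upd compatible_fun_upd)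
    note bottom = R3_bottom_strand[OF sgn x m y ab ab' gc gc', of r]
    have bottom': "transport g' (ordered_pair (\<not> dB) (Under b t) (Under c r)) y = y'"
      using bottom by (simp add: y'_def)
    have "code_coloring w' g' x"
      using g x range_g' c ab ab' gc' bottom'
      by (simp add: w w' code_coloring_def compatible_append transport_append R3_top_strand
          R3_middle_strand R3_bottom_compatible eq flip: m_def y_def y'_def)
    then show ?thesis using m gc unfolding g'_def by blast
  qed
  then obtain m where m: "m \<in> carrier Q" and gc: "g c = (if dM then act s m x else m)"
    and g': "code_coloring w' (g(c := if dM then m else act s m x)) x" by blast
  have "crossings w' = crossings w" using w by auto
  \<comment> \<open>The critical case is \<open>e = c\<close>: of \<open>m\<close> and
    \<open>act s m x\<close>, one equals \<open>x\<close> iff the other does.\<close>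
  moreover have "(g(c := if dM then m else act s m x)) e \<noteq> x"
    using e(2) gc act_eq_self_iff[OF m x, of s] act_idem[OF x, of s] by (cases dM) auto
  ultimately show ?thesis using g' e(1) unfolding code_colorable_def by blast
qed

lemma code_colorable_move:
  assumes "move w w'" "wf_gauss_code w" "wf_gauss_code w'"
  shows "code_colorable w \<longleftrightarrow> code_colorable w'"
  using assms
proof cases
  case (rotate u v)
  then show ?thesis using code_colorable_rotate by blast
next
  case (rename f)
  then show ?thesis using code_colorable_rename by simp
next
  case (R1_over_under a s)
  then show ?thesis using code_colorable_R1[of "[Over a s, Under a s]" w] assms by simp
next
  case (R1_under_over a s)
  then show ?thesis using code_colorable_R1[of "[Under a s, Over a s]" w] assms by simp
next
  case (R2 u v a s b d)
  then show ?thesis using code_colorable_R2[of a s b u d v] assms by simp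
next
  case (R3 s t dM dB r dT a b u c v x)
  show ?thesis
  proof
    show "code_colorable w'" if "code_colorable w"
      using code_colorable_R3[OF assms(2,3), of s t dM dB dT a b u c r v x] R3 that by simp
    show "code_colorable w" if "code_colorable w'"
      using code_colorable_R3[OF assms(3,2), of s t "\<not> dM" "\<not> dB" "\<not> dT" a b u c r v x] R3 that
      by simp
  qed
next
  case (R3' s t dM dB r dT a b u c v x)
  show ?thesis
  proof
    show "code_colorable w'" if "code_colorable w"
      using code_colorable_R3[OF assms(2,3), of s t dM dB dT a b u c r v x] R3' that by simp
    show "code_colorable w" if "code_colorable w'"
      using code_colorable_R3[OF assms(3,2), of s t "\<not> dM" "\<not> dB" "\<not> dT" a b u c r v x] R3' that
      by simp
  qed
qed

lemma code_colorable_knot_equiv: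
  assumes "knot_equiv w w'"
  shows "code_colorable w \<longleftrightarrow> code_colorable w'"
proof -
  have "equivclp diagram_move w w'" using assms by (simp add: knot_equiv_def)
  then show ?thesis
    by induction (auto simp: diagram_move_def knot_diagram_def dest!: code_colorable_move)
qed

end

lemma wf_gauss_code_over_unique:
  assumes wf: "wf_gauss_code w" and less: "i < length w" "j < length w"
    and over: "w ! i = Over c s" "w ! j = Over c s'"
  shows "i = j"
proof -
  have "s = s'"
    using wf_gauss_code_sign[OF wf, of "w ! i" "w ! j"] less over nth_mem[of i w] nth_mem[of j w] by simp
  then show ?thesis
    using nth_eq_iff_index_eq[OF wf_gauss_code_distinct[OF wf] less] over by simp
qed

section \<open>Colorings of a code and homomorphisms from its quandle\<close>

context quandle
begin

text \<open>Aliases for the quandle axioms: in an induction over \<open>qpres_rel\<close>, the cases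
  \<open>idem\<close> and \<open>distrib\<close> bind facts of the same names.\<close>

lemmas op_idem = idem and op_distrib = distrib

primrec eval_qterm :: "('g \<Rightarrow> 'a) \<Rightarrow> 'g qterm \<Rightarrow> 'a" where
  "eval_qterm h (Gen a) = h a"
| "eval_qterm h (QOp s t) = eval_qterm h s \<triangleright> eval_qterm h t"
| "eval_qterm h (QInv s t) = act False (eval_qterm h s) (eval_qterm h t)"

lemma eval_qterm_closed:
  assumes "h \<in> S \<rightarrow> carrier Q"
  shows "t \<in> qterms S \<Longrightarrow> eval_qterm h t \<in> carrier Q"
  using assms by (induction t) (auto simp: qterms_def op_closed act_closed)

lemma eval_qterm_qpres_rel:
  assumes h: "h \<in> S \<rightarrow> carrier Q"
    and R: "\<And>s t. (s, t) \<in> R \<Longrightarrow> eval_qterm h s = eval_qterm h t"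
    and "(s, t) \<in> qpres_rel S R"
  shows "eval_qterm h s = eval_qterm h t"
  using assms(3)
proof induction
  case (idem t)
  then show ?case using eval_qterm_closed[OF h] by (simp add: op_idem)
next
  case (inv_op s t)
  then show ?case using eval_qterm_closed[OF h] by (simp add: op_act_False)
next
  case (op_inv s t)
  then show ?case using eval_qterm_closed[OF h] by (simp add: act_False_op)
next
  case (distrib s t u)
  then show ?case
    using op_distrib[OF eval_qterm_closed[OF h distrib(1)] eval_qterm_closed[OF h distrib(2)]
        eval_qterm_closed[OF h distrib(3)]] by (simp only: eval_qterm.simps)
qed (auto dest: R)

text \<open>The universal property of a presentation. Evaluation respects every rule of
  \<open>qpres_rel\<close>, so the value on a class may be read off from any representative.\<close>

lemma presented_quandle_hom_exists:
  assumes h: "h \<in> S \<rightarrow> carrier Q"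
    and R: "\<And>s t. (s, t) \<in> R \<Longrightarrow> eval_qterm h s = eval_qterm h t"
  shows "\<exists>f\<in>quandle_hom (presented_quandle S R) Q. \<forall>a\<in>S. f (qpres_rel S R `` {Gen a}) = h a"
proof -
  let ?r = "qpres_rel S R"
  define f where "f C = eval_qterm h (SOME t. t \<in> C)" for C
  have f: "f (?r `` {t}) = eval_qterm h t" if "t \<in> qterms S" for t
  proof -
    have "t \<in> ?r `` {t}" using that by (simp add: qpres_rel.refl)
    then have "(SOME u. u \<in> ?r `` {t}) \<in> ?r `` {t}" by (rule someI)
    then have "(t, SOME u. u \<in> ?r `` {t}) \<in> ?r" by simp
    from eval_qterm_qpres_rel[OF h R this] show ?thesis by (simp add: f_def)
  qed
  have car: "\<exists>t\<in>qterms S. C = ?r `` {t}" if "C \<in> carrier (presented_quandle S R)" for C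
    using that by (auto simp: presented_quandle_def quotient_def)
  have "f \<in> quandle_hom (presented_quandle S R) Q"
    unfolding quandle_hom_def
  proof (intro CollectI conjI ballI funcsetI)
    fix C assume "C \<in> carrier (presented_quandle S R)"
    then obtain t where "t \<in> qterms S" "C = ?r `` {t}" using car by blast
    then show "f C \<in> carrier Q" using f eval_qterm_closed[OF h] by simp
  next
    fix C D assume "C \<in> carrier (presented_quandle S R)" "D \<in> carrier (presented_quandle S R)"
    then obtain s t where st: "s \<in> qterms S" "C = ?r `` {s}" "t \<in> qterms S" "D = ?r `` {t}"
      using car by meson
    moreover have "QOp s t \<in> qterms S" using st by (simp add: qterms_def)
    ultimately show "f (C \<triangleright>\<^bsub>presented_quandle S R\<^esub> D) = f C \<triangleright> f D"
      by (simp add: presented_quandle_op f)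
  qed
  moreover have "Gen a \<in> qterms S" if "a \<in> S" for a using that by (simp add: qterms_def)
  ultimately show ?thesis using f by (metis eval_qterm.simps(1))
qed

lemma class_in_presented_quandle:
  "t \<in> qterms S \<Longrightarrow> qpres_rel S R `` {t} \<in> carrier (presented_quandle S R)"
  by (simp add: presented_quandle_def quotientI)

lemma presented_quandle_hom_op:
  assumes f: "f \<in> quandle_hom (presented_quandle S R) Q" and st: "s \<in> qterms S" "t \<in> qterms S"
  shows "f (qpres_rel S R `` {QOp s t}) = f (qpres_rel S R `` {s}) \<triangleright> f (qpres_rel S R `` {t})"
proof -
  have "f (qpres_rel S R `` {s} \<triangleright>\<^bsub>presented_quandle S R\<^esub> qpres_rel S R `` {t})
      = f (qpres_rel S R `` {s}) \<triangleright> f (qpres_rel S R `` {t})"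
    using f class_in_presented_quandle st unfolding quandle_hom_def by blast
  then show ?thesis by (simp only: presented_quandle_op[OF st])
qed

text \<open>At \<open>QInv s t\<close> the value \<open>z\<close> satisfies
  \<open>z \<triangleright> x = x = x \<triangleright> x\<close>, and translations are injective.
  Nonconstancy can thus be detected on the arcs.\<close>

lemma presented_quandle_hom_constant:
  assumes f: "f \<in> quandle_hom (presented_quandle S R) Q" and x: "x \<in> carrier Q"
    and gen: "\<And>a. a \<in> S \<Longrightarrow> f (qpres_rel S R `` {Gen a}) = x"
  shows "t \<in> qterms S \<Longrightarrow> f (qpres_rel S R `` {t}) = x"
proof (induction t)
  let ?c = "\<lambda>t. qpres_rel S R `` {t}"
  note op = presented_quandle_hom_op[OF f]
  {
    case (Gen a)
    then show ?case using gen by (simp add: qterms_def)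
  next
    case (QOp s t)
    then have "s \<in> qterms S" "t \<in> qterms S" by (auto simp: qterms_def)
    then show ?case using QOp op x by (simp add: op_idem)
  next
    case (QInv s t)
    then have st: "s \<in> qterms S" "t \<in> qterms S" by (auto simp: qterms_def)
    have "?c (QOp (QInv s t) t) = ?c s"
      using st by (intro equiv_class_eq[OF equiv_qpres_rel] qpres_rel.op_inv)
    then have "f (?c (QInv s t)) \<triangleright> x = x"
      using op[OF QInv(3) st(2)] QInv st by simp
    moreover have "f (?c (QInv s t)) \<in> carrier Q"
      using f class_in_presented_quandle[OF QInv(3)] unfolding quandle_hom_def by auto
    ultimately show ?case using op_cancel[of "f (?c (QInv s t))" x x] x by (simp add: op_idem)
  }
qed

lemma transport_take_Suc:
  assumes "i < length w"
  shows "transport g (take (Suc i) w) x = transport g [w ! i] (transport g (take i w) x)"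
  using assms by (simp add: take_Suc_conv_app_nth transport_append)

lemma compatible_take_Suc:
  assumes "i < length w"
  shows "compatible g (take (Suc i) w) x \<longleftrightarrow>
    compatible g (take i w) x \<and> compatible g [w ! i] (transport g (take i w) x)"
  using assms by (simp add: take_Suc_conv_app_nth compatible_append)

lemma code_colorable_if_hom:
  assumes wf: "wf_gauss_code w" and f: "f \<in> quandle_hom (diagram_quandle w) Q"
    and xy: "C \<in> carrier (diagram_quandle w)" "D \<in> carrier (diagram_quandle w)" "f C \<noteq> f D"
  shows "code_colorable w"
proof -
  let ?S = "arcs w" and ?R = "crossing_relations w"
  let ?c = "\<lambda>t. qpres_rel ?S ?R `` {t}"
  define e where "e i = f (?c (Gen (arc_of w i)))" for i
  have gen: "Gen (arc_of w i) \<in> qterms ?S" if "i \<in> edges w" for i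
    using that by (simp add: qterms_def arcs_def)
  have edge: "i \<in> edges w" if "i < length w" for i using that by (simp add: edges_def)
  have closed: "?c t \<in> carrier (diagram_quandle w)" if "t \<in> qterms ?S" for t
    using class_in_presented_quandle[OF that] by (simp add: diagram_quandle_def)
  have e_closed: "e i \<in> carrier Q" if "i \<in> edges w" for i
    using f closed[OF gen[OF that]] unfolding e_def quandle_hom_def by auto
  have e0: "e 0 \<in> carrier Q" by (rule e_closed) (simp add: edges_def)
  have over: "e (next_edge w i) = e i" if "i < length w" "is_over (w ! i)" for i
  proof -
    have "over_adjacent w i (next_edge w i)" using that by (simp add: over_adjacent_def)
    then have "equivclp (over_adjacent w) i (next_edge w i)" by (rule r_into_equivclp)
    then have "arc_of w i = arc_of w (next_edge w i)"
      unfolding arc_of_def by (auto intro: equivclp_trans equivclp_sym)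
    then show ?thesis by (simp add: e_def)
  qed
  have rel: "e i \<triangleright> e j = e k"
    if "(QOp (Gen (arc_of w i)) (Gen (arc_of w j)), Gen (arc_of w k)) \<in> ?R"
      "i \<in> edges w" "j \<in> edges w" "k \<in> edges w" for i j k
  proof -
    have "QOp (Gen (arc_of w i)) (Gen (arc_of w j)) \<in> qterms ?S"
      using that by (simp add: qterms_def arcs_def)
    then have "?c (QOp (Gen (arc_of w i)) (Gen (arc_of w j))) = ?c (Gen (arc_of w k))"
      using that gen by (intro equiv_class_eq[OF equiv_qpres_rel] qpres_rel.rel)
    then show ?thesis
      using presented_quandle_hom_op[OF f[unfolded diagram_quandle_def] gen[OF that(2)] gen[OF that(3)]]
      by (simp add: e_def)
  qed
  \<comment> \<open>The choice picks the unique over-passage of \<open>c\<close>. Labels that are no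
    crossing get \<open>e 0\<close>, so that the range stays in the carrier.\<close>
  define g where "g c = (if \<exists>i s. i < length w \<and> w ! i = Over c s
    then e (SOME i. i < length w \<and> (\<exists>s. w ! i = Over c s)) else e 0)" for c
  have g_over: "g c = e i" if "i < length w" "w ! i = Over c s" for i c s
  proof -
    let ?j = "SOME i. i < length w \<and> (\<exists>s. w ! i = Over c s)"
    have j: "?j < length w \<and> (\<exists>s. w ! ?j = Over c s)"
      by (rule someI[of _ i]) (use that in auto)
    then have "?j = i" using wf_gauss_code_over_unique[OF wf _ that(1) _ that(2)] by blast
    then show ?thesis using that unfolding g_def by auto
  qed
  have g_closed: "range g \<subseteq> carrier Q"
  proof -
    have "g c \<in> carrier Q" for c
    proof (cases "\<exists>i s. i < length w \<and> w ! i = Over c s")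
      case True
      then show ?thesis using g_over e_closed edge by metis
    qed (use e0 in \<open>auto simp: g_def\<close>)
    then show ?thesis by blast
  qed
  have step: "compatible g [w ! i] (e i) \<and> transport g [w ! i] (e i) = e (next_edge w i)"
    if i: "i < length w" for i
  proof (cases "w ! i")
    case (Over c s)
    then show ?thesis using g_over[OF i] over[OF i] by simp
  next
    case (Under c s)
    let ?j = "partner w i"
    have j: "?j < length w" "w ! ?j = Over c s" using partner[OF wf i] Under by auto
    have gc: "g c = e ?j" by (rule g_over[OF j])
    have edges: "i \<in> edges w" "next_edge w i \<in> edges w" "?j \<in> edges w"
      using edge i j next_edge_less by auto
    have "act s (e i) (g c) = e (next_edge w i)"
    proof (cases s)
      case True
      have "(QOp (Gen (arc_of w i)) (Gen (arc_of w ?j)), Gen (arc_of w (next_edge w i))) \<in> ?R"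
        unfolding crossing_relations_def using i j Under True by auto
      from rel[OF this] edges show ?thesis using True by (simp add: act_def gc)
    next
      case False
      have "(QOp (Gen (arc_of w (next_edge w i))) (Gen (arc_of w ?j)), Gen (arc_of w i)) \<in> ?R"
        unfolding crossing_relations_def using i j Under False by auto
      from rel[OF this] edges have "e (next_edge w i) \<triangleright> e ?j = e i" by simp
      then show ?thesis
        using op_act_False[of "e (next_edge w i)" "e ?j"] edges e_closed False by (simp add: gc)
    qed
    then show ?thesis using Under by simp
  qed
  \<comment> \<open>The index wraps only at \<open>k = length w\<close>, where the statement becomes
    the closing condition of a coloring.\<close>
  have run: "compatible g (take k w) (e 0) \<and> transport g (take k w) (e 0) = e (k mod length w)"
    if "k \<le> length w" for k
    using that
  proof (induction k)
    case (Suc k)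
    then show ?case
      using step[of k] by (simp add: transport_take_Suc compatible_take_Suc next_edge_def)
  qed simp
  have "code_coloring w g (e 0)"
    using run[of "length w"] e0 g_closed by (simp add: code_coloring_def)
  moreover have "\<exists>c\<in>crossings w. g c \<noteq> e 0"
  proof (rule ccontr)
    assume "\<not> ?thesis"
    then have const: "g c = e 0" if "c \<in> crossings w" for c using that by blast
    have "e i = e 0" if i: "i \<in> edges w" for i
    proof (cases "i < length w")
      case True
      have "transport g (take i w) (e 0) = e 0"
      proof (rule transport_constant[OF e0])
        show "g c = e 0" if "c \<in> crossings (take i w)" for c
          using that set_take_subset[of i w] by (intro const) (auto simp: crossings_def)
      qed
      then show ?thesis using run[of i] True by simp
    next
      case False
      then show ?thesis using i by (auto simp: edges_def max_def split: if_splits)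
    qed
    then have gen_const: "f (?c (Gen a)) = e 0" if "a \<in> arcs w" for a
      using that by (auto simp: arcs_def e_def)
    have "f E = e 0" if E: "E \<in> carrier (diagram_quandle w)" for E
    proof -
      obtain t where "t \<in> qterms ?S" "E = ?c t"
        using E by (auto simp: diagram_quandle_def presented_quandle_def quotient_def)
      then show ?thesis
        using presented_quandle_hom_constant[OF f[unfolded diagram_quandle_def] e0 gen_const] by simp
    qed
    then show False using xy by simp
  qed
  ultimately show ?thesis unfolding code_colorable_def by blast
qed

lemma hom_if_code_colorable:
  assumes wf: "wf_gauss_code w" and "code_colorable w"
  shows "\<exists>f\<in>quandle_hom (diagram_quandle w) Q.
    \<exists>C\<in>carrier (diagram_quandle w). \<exists>D\<in>carrier (diagram_quandle w). f C \<noteq> f D"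
proof -
  let ?S = "arcs w" and ?R = "crossing_relations w"
  let ?c = "\<lambda>t. qpres_rel ?S ?R `` {t}"
  obtain g x b where x: "x \<in> carrier Q" and g: "range g \<subseteq> carrier Q"
    and comp: "compatible g w x" and run: "transport g w x = x"
    and b: "b \<in> crossings w" "g b \<noteq> x"
    using assms(2) by (auto simp: code_colorable_def code_coloring_def)
  define e where "e i = transport g (take i w) x" for i
  have e_closed: "e i \<in> carrier Q" for i using x g by (simp add: e_def transport_closed)
  have e_next: "e (next_edge w i) = transport g [w ! i] (e i)" if "i < length w" for i
  proof (cases "Suc i = length w")
    case True
    then have "e (Suc i) = e (next_edge w i)" using run by (simp add: e_def next_edge_def)
    then show ?thesis using that by (simp add: e_def transport_take_Suc)
  next
    case False
    then show ?thesis using that by (simp add: e_def transport_take_Suc next_edge_def)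
  qed
  have e_over: "e i = g c" if "i < length w" "w ! i = Over c s" for i c s
  proof -
    have "compatible g (take (Suc i) w @ drop (Suc i) w) x" using comp by simp
    then have "compatible g (take (Suc i) w) x" unfolding compatible_append by blast
    then show ?thesis using that by (simp add: compatible_take_Suc e_def)
  qed
  have "e i = e j" if "equivclp (over_adjacent w) i j" for i j
    using that
  proof induction
    case (step y z)
    have "e k = e l" if "over_adjacent w k l" for k l
      using that e_next[of k] by (cases "w ! k") (auto simp: over_adjacent_def)
    then show ?case using step by metis
  qed simp
  then have e_arc: "e i = e j" if "arc_of w i = arc_of w j" for i j
    using that equivclp_refl[of "over_adjacent w" j] unfolding arc_of_def by blast
  \<comment> \<open>Any edge of the arc will do: passing over a strand leaves the color unchanged,
    so \<open>e\<close> is constant on arcs.\<close>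
  define h where "h a = e (SOME i. a = arc_of w i)" for a
  have h: "h (arc_of w i) = e i" for i
    unfolding h_def by (rule e_arc[symmetric], rule someI[of _ i]) (rule HOL.refl)
  have R: "eval_qterm h s = eval_qterm h t" if "(s, t) \<in> ?R" for s t
    using that unfolding crossing_relations_def
  proof (elim UnE CollectE exE conjE Pair_inject)
    fix i j c
    assume "i < length w" "j < length w" "w ! i = Over c True" "w ! j = Under c True"
      "s = QOp (Gen (arc_of w j)) (Gen (arc_of w i))" "t = Gen (arc_of w (next_edge w j))"
    then show ?thesis using e_over[of i] e_next[of j] by (simp add: h act_def)
  next
    fix i j c
    assume "i < length w" "j < length w" "w ! i = Over c False" "w ! j = Under c False"
      "s = QOp (Gen (arc_of w (next_edge w j))) (Gen (arc_of w i))" "t = Gen (arc_of w j)"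
    then show ?thesis
      using e_over[of i c False] e_next[of j] act_False_op[of "e j" "g c"] e_closed[of i] e_closed[of j]
      by (simp add: h)
  qed
  have "h \<in> ?S \<rightarrow> carrier Q" by (auto simp: arcs_def h e_closed)
  from presented_quandle_hom_exists[OF this R]
  obtain f where f: "f \<in> quandle_hom (diagram_quandle w) Q" "\<And>a. a \<in> ?S \<Longrightarrow> f (?c (Gen a)) = h a"
    unfolding diagram_quandle_def by blast
  have arc: "arc_of w i \<in> ?S" "?c (Gen (arc_of w i)) \<in> carrier (diagram_quandle w)"
    if "i \<in> edges w" for i
    using that by (auto simp: arcs_def diagram_quandle_def qterms_def
        intro!: class_in_presented_quandle)
  obtain p where p: "p \<in> set w" "crossing p = b" using b(1) by (auto simp: crossings_def)
  then obtain i where i: "i < length w" "w ! i = Over b (positive p)"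
    using wf_gauss_code_passages(1)[OF wf] by (metis in_set_conv_nth)
  have edges: "i \<in> edges w" "0 \<in> edges w" using i by (auto simp: edges_def)
  have "f (?c (Gen (arc_of w i))) = g b" "f (?c (Gen (arc_of w 0))) = x"
    using f(2) arc(1) edges e_over[OF i] by (auto simp: h) (simp add: e_def)
  then show ?thesis using f(1) arc(2)[OF edges(1)] arc(2)[OF edges(2)] b(2) by metis
qed

text \<open>The fundamental quandle is built on \<open>rep_knot K\<close>; move invariance transfers
  the question to any diagram, in particular to a concatenation.\<close>

lemma nonconstant_coloring_iff:
  assumes "diagram_of w K"
  shows "(\<exists>f. nonconstant_coloring K Q f) \<longleftrightarrow> code_colorable w"
proof -
  have wf: "wf_gauss_code (rep_knot K)"
    using diagram_of_rep_knot[of K] by (simp add: diagram_of_def knot_diagram_def)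
  have "code_colorable w \<longleftrightarrow> code_colorable (rep_knot K)"
    using assms diagram_of_iff_knot_equiv code_colorable_knot_equiv by blast
  also have "\<dots> \<longleftrightarrow> (\<exists>f. nonconstant_coloring K Q f)"
    unfolding nonconstant_coloring_def fundamental_quandle_def
    using code_colorable_if_hom[OF wf] hom_if_code_colorable[OF wf] by blast
  finally show ?thesis by blast
qed

section \<open>Colorings of a concatenation\<close>

lemma code_colorable_append:
  assumes long: "\<And>g x. x \<in> carrier Q \<Longrightarrow> range g \<subseteq> carrier Q \<Longrightarrow> compatible g v x \<Longrightarrow> transport g v x = x"
    and disj: "crossings v \<inter> crossings w = {}"
  shows "code_colorable (v @ w) \<longleftrightarrow> code_colorable v \<or> code_colorable w"
proof
  assume "code_colorable (v @ w)"
  then obtain g x c where x: "x \<in> carrier Q" and g: "range g \<subseteq> carrier Q"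
    and comp: "compatible g v x" "compatible g w (transport g v x)"
    and run: "transport g w (transport g v x) = x"
    and c: "c \<in> crossings v \<union> crossings w" "g c \<noteq> x"
    unfolding code_colorable_def code_coloring_def compatible_append transport_append crossings_append
    by blast
  have "transport g v x = x" by (rule long[OF x g comp(1)])
  then have "code_coloring v g x" "code_coloring w g x"
    using x g comp run by (auto simp: code_coloring_def)
  then show "code_colorable v \<or> code_colorable w" using c unfolding code_colorable_def by blast
next
  have ext: "\<exists>g' c. range g' \<subseteq> carrier Q \<and> x \<in> carrier Q \<and> compatible g' u x \<and> transport g' u x = x
      \<and> compatible g' u' x \<and> transport g' u' x = x \<and> c \<in> crossings u \<and> g' c \<noteq> x"
    if g: "code_coloring u g x" and c: "c \<in> crossings u" "g c \<noteq> x" and disj: "crossings u \<inter> crossings u' = {}"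
    for u u' g x c
  proof -
    \<comment> \<open>The colors are reset off \<open>u\<close>, since \<open>g\<close> may take
      arbitrary values at the crossings of \<open>u'\<close>.\<close>
    let ?g = "\<lambda>c. if c \<in> crossings u then g c else x"
    have x: "x \<in> carrier Q" using g by (simp add: code_coloring_def)
    have "transport ?g u x = transport g u x" "compatible ?g u x = compatible g u x"
      by (auto intro!: transport_cong compatible_cong)
    moreover have const: "?g d = x" if "d \<in> crossings u'" for d using that disj by auto
    have "transport ?g u' x = x" "compatible ?g u' x"
      using transport_constant[of x u' ?g] compatible_constant[of x u' ?g] x const by auto
    moreover have "range ?g \<subseteq> carrier Q" using g by (auto simp: code_coloring_def)
    ultimately show ?thesis using g c x
      by (intro exI[of _ ?g] exI[of _ c]) (auto simp: code_coloring_def)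
  qed
  assume "code_colorable v \<or> code_colorable w"
  then show "code_colorable (v @ w)"
  proof
    assume "code_colorable v"
    then obtain g x c where "code_coloring v g x" "c \<in> crossings v" "g c \<noteq> x"
      unfolding code_colorable_def by blast
    from ext[OF this disj] show ?thesis
      unfolding code_colorable_def code_coloring_def compatible_append transport_append crossings_append
      by (metis UnCI)
  next
    assume "code_colorable w"
    then obtain g x c where "code_coloring w g x" "c \<in> crossings w" "g c \<noteq> x"
      unfolding code_colorable_def by blast
    from ext[OF this, of v] disj show ?thesis
      unfolding code_colorable_def code_coloring_def compatible_append transport_append crossings_append
      by (metis UnCI inf_commute)
  qed
qed

end

section \<open>Alexander colorings of a cut diagram\<close>

text \<open>The cancellation at a crossing: \<open>inv u\<close> is the change at the over-passage,
  the other factor the change at the under-passage.\<close>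

lemma (in comm_group) inv_mult_conj:
  "u \<in> carrier G \<Longrightarrow> r \<in> carrier G \<Longrightarrow> inv u \<otimes> ((r \<otimes> u) \<otimes> inv r) = \<one>"
  by (simp add: m_ac) (metis inv_closed m_lcomm r_inv r_one)

lemma (in comm_group) finprod_telescope:
  assumes "F \<in> UNIV \<rightarrow> carrier G"
  shows "(\<Otimes>i\<in>{..<n::nat}. F (Suc i) \<otimes> inv F i) = F n \<otimes> inv F 0"
proof (induction n)
  case 0
  have "F 0 \<in> carrier G" using assms by auto
  then show ?case by simp
next
  case (Suc n)
  have F: "F i \<in> carrier G" for i using assms by auto
  have "(\<Otimes>i\<in>{..<Suc n}. F (Suc i) \<otimes> inv F i) = (F (Suc n) \<otimes> inv F n) \<otimes> (F n \<otimes> inv F 0)"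
    unfolding lessThan_Suc using F by (subst finprod_insert) (simp_all del: finprod_multf add: Suc)
  also have "\<dots> = F (Suc n) \<otimes> inv F 0"
    using F by (simp add: m_assoc) (simp add: m_assoc[symmetric])
  finally show ?case .
qed

text \<open>
  With \<open>H\<close> from \<open>alexander_numbering_nat\<close>, apply \<open>\<phi> ^^ H i\<close> to the color of edge \<open>i\<close>. The changes of
  the resulting value at the two passages of a crossing cancel, so it is the same at both ends of
  the code.
\<close>

lemma (in comm_group) alexander_transport:
  fixes \<phi> :: "'a \<Rightarrow> 'a"
  defines "Q \<equiv> alexander_quandle G \<phi>"
  assumes \<phi>: "\<phi> \<in> iso G G" and w: "knot_diagram w"
    and x: "x \<in> carrier Q" and g: "range g \<subseteq> carrier Q" and comp: "quandle.compatible Q g w x"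
  shows "quandle.transport Q g w x = x"
proof -
  interpret Q: quandle Q
    unfolding Q_def using \<phi> by (rule alexander_quandle_is_quandle[OF comm_group_axioms])
  have carrier: "carrier Q = carrier G" by (simp add: Q_def alexander_quandle_def)
  have qop: "a \<triangleright>\<^bsub>Q\<^esub> b = \<phi> a \<otimes> (b \<otimes> inv \<phi> b)" for a b by (simp add: Q_def alexander_quandle_def)
  have hom: "\<phi> \<in> hom G G" and bij: "bij_betw \<phi> (carrier G) (carrier G)"
    using \<phi> by (auto simp: iso_def)
  have wf: "wf_gauss_code w" using w by (simp add: knot_diagram_def)
  obtain H :: "nat \<Rightarrow> nat" where H0: "H (length w) = H 0"
    and H: "\<And>i. i < length w \<Longrightarrow> crossed_leftwards w i \<Longrightarrow> H (Suc i) = Suc (H i) \<and>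
      H (partner w i) = Suc (H i) \<and> H (Suc (partner w i)) = H i"
    using alexander_numbering_nat[OF w] by blast
  have pow_closed: "(\<phi> ^^ k) a \<in> carrier G" if "a \<in> carrier G" for k a
    using that hom by (induction k) (auto simp: hom_def)
  have pow_mult: "(\<phi> ^^ k) (a \<otimes> b) = (\<phi> ^^ k) a \<otimes> (\<phi> ^^ k) b"
    if "a \<in> carrier G" "b \<in> carrier G" for k a b
    using that hom pow_closed by (induction k) (auto simp: hom_def)
  have pow_inv: "(\<phi> ^^ k) (inv a) = inv ((\<phi> ^^ k) a)" if "a \<in> carrier G" for k a
  proof -
    have "group_hom G G (\<phi> ^^ k)"
      using pow_closed pow_mult by unfold_locales (auto simp: hom_def)
    from group_hom.hom_inv[OF this that] show ?thesis .
  qed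
  have \<phi>_closed: "\<phi> a \<in> carrier G" if "a \<in> carrier G" for a using pow_closed[OF that, of 1] by simp
  have pow_op: "(\<phi> ^^ k) (a \<triangleright>\<^bsub>Q\<^esub> b) =
      (\<phi> ^^ Suc k) a \<otimes> ((\<phi> ^^ k) b \<otimes> inv ((\<phi> ^^ Suc k) b))" if "a \<in> carrier G" "b \<in> carrier G" for k a b
    using that by (simp add: qop pow_mult pow_inv \<phi>_closed funpow_swap1)
  define e where "e i = Q.transport g (take i w) x" for i
  have e: "e i \<in> carrier G" for i
    using Q.transport_closed[OF x g] by (simp add: e_def carrier)
  have e_over: "e (Suc i) = e i" "g c = e i" if "i < length w" "w ! i = Over c s" for i c s
  proof -
    have "Q.compatible g (take (Suc i) w @ drop (Suc i) w) x" using comp by simp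
    then have "Q.compatible g (take (Suc i) w) x" unfolding Q.compatible_append by blast
    then show "e (Suc i) = e i" "g c = e i"
      using that by (simp_all add: Q.transport_take_Suc Q.compatible_take_Suc e_def)
  qed
  define F where "F i = (\<phi> ^^ H i) (e i)" for i
  have F: "F i \<in> carrier G" for i by (simp add: F_def pow_closed e)
  define d where "d i = F (Suc i) \<otimes> inv F i" for i
  have d: "d i \<in> carrier G" for i by (simp add: d_def F)
  define U where "U = {i. i < length w \<and> is_over (w ! i)}"
  have cancel: "d i \<otimes> d (partner w i) = \<one>" if iU: "i \<in> U" for i
  proof -
    obtain c s where i: "i < length w" "w ! i = Over c s"
      using iU by (cases "w ! i") (auto simp: U_def)
    define j where "j = partner w i"
    have j: "j < length w" "w ! j = Under c s" "partner w j = i"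
      using partner[OF wf i(1)] partner_partner[OF wf i(1)] i(2) by (auto simp: j_def)
    have y: "e (Suc i) = e i" "g c = e i" using e_over[OF i] by auto
    have out: "e (Suc j) = Q.act s (e j) (e i)"
      using j y by (simp add: e_def Q.transport_take_Suc)
    show ?thesis
    proof (cases s)
      case True
      have Hs: "H (Suc i) = Suc (H i)" "H j = Suc (H i)" "H (Suc j) = H i"
        using H[OF i(1)] i True by (auto simp: crossed_leftwards_def j_def)
      let ?u = "F i \<otimes> inv F (Suc i)"
      \<comment> \<open>The numbering is made for this step. With
        \<open>k = H (Suc j) = H i\<close>, the exponent \<open>Suc k\<close> is both
        \<open>H j\<close> and \<open>H (Suc i)\<close>, so the three terms of \<open>pow_op\<close>
        are values of \<open>F\<close>, the last one inverted.\<close>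
      have "F (Suc j) = F j \<otimes> ?u"
        using out True by (simp add: F_def Hs Q.act_def pow_op[OF e e] y del: funpow.simps)
      then show ?thesis
        using inv_mult_conj[of ?u "F j"] F by (simp add: d_def inv_mult m_comm flip: j_def)
    next
      case False
      have Hs: "H (Suc j) = Suc (H j)" "H i = Suc (H j)" "H (Suc i) = H j"
        using H[OF j(1)] j False by (auto simp: crossed_leftwards_def)
      \<comment> \<open>At a negative crossing the relation expresses the incoming color by the
        outgoing one, so the two ends of each strand exchange roles.\<close>
      have ej: "e j = e (Suc j) \<triangleright>\<^bsub>Q\<^esub> e i"
        using out False Q.act_False_op[of "e j" "e i"] e by (simp add: carrier)
      let ?u = "F (Suc i) \<otimes> inv F i"
      have "F j = F (Suc j) \<otimes> ?u"
        unfolding F_def Hs y(1) by (subst ej) (rule pow_op[OF e e])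
      then show ?thesis
        using inv_mult_conj[of "inv ?u" "F (Suc j)"] F
        by (simp add: d_def inv_mult m_ac flip: j_def)
    qed
  qed
  \<comment> \<open>Each passage is an over-passage or the partner of exactly one, so the
    telescoping product regroups into one trivial factor per crossing.\<close>
  have V: "{..<length w} = U \<union> partner w ` U" "U \<inter> partner w ` U = {}" "inj_on (partner w) U"
  proof -
    show "inj_on (partner w) U"
      using partner_partner[OF wf] by (intro inj_on_inverseI[of _ "partner w"]) (auto simp: U_def)
    have not_over: "is_over (w ! partner w i) \<longleftrightarrow> \<not> is_over (w ! i)" if "i < length w" for i
      using partner(2)[OF wf that] by (cases "w ! i") auto
    then show "U \<inter> partner w ` U = {}" by (auto simp: U_def)
    have "i \<in> partner w ` U" if "i < length w" "i \<notin> U" for i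
      using that not_over partner(1)[OF wf] partner_partner[OF wf]
      by (intro image_eqI[of _ _ "partner w i"]) (auto simp: U_def)
    then show "{..<length w} = U \<union> partner w ` U"
      using partner(1)[OF wf] by (auto simp: U_def)
  qed
  have "F (length w) \<otimes> inv F 0 = (\<Otimes>i\<in>{..<length w}. d i)"
    unfolding d_def using finprod_telescope[of F "length w"] F by simp
  also have "\<dots> = (\<Otimes>i\<in>U. d i) \<otimes> (\<Otimes>i\<in>partner w ` U. d i)"
    unfolding V(1) using V(2) d by (intro finprod_Un_disjoint) (auto simp: U_def)
  also have "(\<Otimes>i\<in>partner w ` U. d i) = (\<Otimes>i\<in>U. d (partner w i))"
    using V(3) d by (intro finprod_reindex) auto
  also have "(\<Otimes>i\<in>U. d i) \<otimes> (\<Otimes>i\<in>U. d (partner w i)) = (\<Otimes>i\<in>U. d i \<otimes> d (partner w i))"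
    using d by (intro finprod_multf[symmetric]) auto
  also have "\<dots> = (\<Otimes>i\<in>U. \<one>)"
    using cancel by (intro finprod_cong) (auto simp: simp_implies_def)
  also have "\<dots> = \<one>" by simp
  finally have "F (length w) = F 0"
    using F by (metis inv_closed inv_inv inv_equality)
  then have "(\<phi> ^^ H 0) (e (length w)) = (\<phi> ^^ H 0) (e 0)" by (simp add: F_def H0)
  moreover have "inj_on (\<phi> ^^ k) (carrier G)" for k
  proof (induction k)
    case (Suc k)
    have "inj_on \<phi> ((\<phi> ^^ k) ` carrier G)"
      using bij pow_closed by (auto simp: bij_betw_def intro: inj_on_subset)
    then show ?case using comp_inj_on[OF Suc, of \<phi>] by (simp add: o_def)
  qed simp
  ultimately have "e (length w) = e 0" using e by (meson inj_onD)
  then show ?thesis by (simp add: e_def)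
qed

section \<open>The Frobenius automorphism\<close>

text \<open>Multiplication by a nonzero \<open>x\<close> permutes the nonzero elements; comparing
  the products over all of them shows that the power of \<open>x\<close> with exponent
  \<open>CARD('k) - 1\<close> is 1.\<close>

lemma finite_field_power_card:
  fixes x :: "'k::{field,finite}"
  shows "x ^ CARD('k) = x"
proof (cases "x = 0")
  case False
  let ?S = "UNIV - {0 :: 'k}"
  have bij: "bij_betw ((*) x) ?S ?S"
    using False by (intro bij_betwI[where g = "\<lambda>y. y / x"]) auto
  have "\<Prod>?S = (\<Prod>y\<in>?S. x * y)"
    using prod.reindex_bij_betw[OF bij, of "\<lambda>y. y"] by simp
  also have "\<dots> = x ^ card ?S * \<Prod>?S" by (simp add: prod.distrib)
  finally have "x ^ card ?S * \<Prod>?S = 1 * \<Prod>?S" by (simp only: mult_1)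
  moreover have "\<Prod>?S \<noteq> 0" by simp
  ultimately have "x ^ card ?S = 1" using mult_right_cancel by blast
  moreover have "CARD('k) = Suc (card ?S)"
    using card_Suc_Diff1[of "UNIV :: 'k set" 0] by (simp del: card_Diff_insert)
  ultimately show ?thesis by (simp only: power_Suc mult_1_right)
qed (simp add: zero_power)

text \<open>
  The polynomial \<open>(X + 1) ^ q - X ^ q - 1\<close> has degree less than \<open>q\<close> and vanishes at all \<open>q\<close>
  elements of the field.
\<close>

lemma of_nat_card_choose_eq_0:
  assumes "0 < i" "i < CARD('k::{field,finite})"
  shows "of_nat (CARD('k) choose i) = (0 :: 'k)"
proof -
  define q where "q = CARD('k)"
  define P :: "'k poly" where "P = (\<Sum>i\<in>{0<..<q}. monom (of_nat (q choose i)) i)"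
  have "poly P c = 0" for c
  proof -
    have q: "q > 0" by (simp add: q_def)
    have split: "{..q} = insert 0 (insert q {0<..<q})" by auto
    have "c + 1 = (c + 1) ^ q" unfolding q_def by (rule finite_field_power_card[symmetric])
    also have "\<dots> = (\<Sum>i\<le>q. of_nat (q choose i) * c ^ i)" by (simp add: binomial_ring)
    also have "\<dots> = 1 + c ^ q + poly P c"
      using q unfolding split by (simp add: P_def poly_sum poly_monom)
    also have "c ^ q = c" unfolding q_def by (rule finite_field_power_card)
    finally show ?thesis by simp
  qed
  then have "{c. poly P c = 0} = UNIV" by simp
  moreover have "degree P < q"
    unfolding P_def
    by (rule degree_sum_less) (auto simp: q_def intro: le_less_trans[OF degree_monom_le])
  ultimately have "P = 0"
    using card_poly_roots_bound[of P] by (auto simp: q_def)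
  then have "coeff P i = 0" by simp
  moreover have "coeff P i = of_nat (q choose i)"
    using assms unfolding P_def coeff_sum by (simp add: q_def)
  ultimately show ?thesis by (simp add: q_def)
qed

text \<open>The inner binomial coefficients vanish in \<open>'k\<close>, hence in its closure;
  \<open>CARD('k)\<close> is treated directly and not as a power of the characteristic.\<close>

lemma power_card_add:
  fixes x y :: "'k::{field,finite} alg_closure"
  shows "(x + y) ^ CARD('k) = x ^ CARD('k) + y ^ CARD('k)"
proof -
  define q where "q = CARD('k)"
  have q: "q > 0" by (simp add: q_def)
  have split: "{..q} = insert 0 (insert q {0<..<q})" by auto
  have "of_nat (q choose i) = (0 :: 'k alg_closure)" if "i \<in> {0<..<q}" for i
  proof -
    have "to_ac (of_nat (q choose i) :: 'k) = to_ac 0"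
      using that of_nat_card_choose_eq_0[where 'k = 'k, of i] by (simp add: q_def del: to_ac_of_nat)
    then show ?thesis by simp
  qed
  then have "(\<Sum>i\<in>{0<..<q}. of_nat (q choose i) * x ^ i * y ^ (q - i)) = 0" by simp
  then have "(x + y) ^ q = x ^ q + y ^ q"
    using q unfolding binomial_ring split by (simp add: add.commute)
  then show ?thesis by (simp add: q_def)
qed

lemma power_card_sum:
  fixes f :: "'b \<Rightarrow> 'k::{field,finite} alg_closure"
  shows "(\<Sum>i\<in>S. f i) ^ CARD('k) = (\<Sum>i\<in>S. f i ^ CARD('k))"
  by (induction S rule: infinite_finite_induct) (auto simp: power_card_add zero_power)

lemma inj_power_card: "inj (\<lambda>x :: 'k::{field,finite} alg_closure. x ^ CARD('k))"
proof (rule injI)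
  fix x y :: "'k alg_closure"
  assume "x ^ CARD('k) = y ^ CARD('k)"
  then have "(x - y) ^ CARD('k) = 0"
    using power_card_add[of "x - y" y] by simp
  then show "x = y" by simp
qed

lemma peval_power_card:
  fixes f :: "('v \<Rightarrow>\<^sub>0 nat) \<Rightarrow>\<^sub>0 'k::{field,finite}" and x :: "'v \<Rightarrow> 'k alg_closure"
  shows "peval to_ac f (\<lambda>i. x i ^ CARD('k)) = peval to_ac f x ^ CARD('k)"
proof -
  have "to_ac c ^ CARD('k) = to_ac c" for c :: 'k
    by (metis finite_field_power_card to_ac_power)
  then show ?thesis
    unfolding peval_def power_card_sum
    by (simp add: power_mult_distrib prod_power_distrib mult.commute flip: power_mult)
qed

lemma frobenius_proj_point:
  fixes v :: "'n \<Rightarrow> 'k::{field,finite} alg_closure"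
  shows "frobenius (proj_point v) = proj_point (\<lambda>i. v i ^ CARD('k))"
proof -
  have "\<exists>c'. c = c' ^ CARD('k) \<and> c' \<noteq> 0" if "c \<noteq> 0" for c :: "'k alg_closure"
    using nth_root_exists[of "CARD('k)" c] that by (auto simp: zero_power)
  then show ?thesis
    unfolding frobenius_def proj_point_def
    by (force simp: image_iff power_mult_distrib)
qed

lemma inj_frobenius: "inj (frobenius :: ('n, 'k::{field,finite} alg_closure) proj_point \<Rightarrow> _)"
proof -
  have "inj (\<lambda>v (i :: 'n). (v i :: 'k alg_closure) ^ CARD('k))"
    using inj_power_card by (auto simp: inj_def fun_eq_iff)
  from inj_image_eq_iff[OF this] show ?thesis by (intro injI) (simp add: frobenius_def)
qed

text \<open>The values of the defining equations at the image are powers of their values at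
  \<open>P\<close>, so they vanish together. The equivalence yields both invariance of the variety
  and surjectivity on it.\<close>

lemma frobenius_mem_iff:
  fixes V :: "('n::finite, 'k::{field,finite} alg_closure) proj_point set"
  assumes V: "closed_over (to_ac :: 'k \<Rightarrow> _) V" and P: "P \<in> proj_space"
  shows "frobenius P \<in> V \<longleftrightarrow> P \<in> V"
proof -
  obtain F :: "(('n \<Rightarrow>\<^sub>0 nat) \<Rightarrow>\<^sub>0 'k) set"
    where F: "V = {P \<in> proj_space. \<forall>f\<in>F. \<forall>v\<in>P. peval to_ac f v = 0}"
    using V unfolding closed_over_def by blast
  obtain v where v: "v \<noteq> (\<lambda>_. 0)" "P = proj_point v" using P by (auto simp: proj_space_def)
  have "(\<lambda>i. v i ^ CARD('k)) \<noteq> (\<lambda>_. 0)" using v(1) by (auto simp: fun_eq_iff)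
  then have "frobenius P \<in> proj_space"
    unfolding v(2) frobenius_proj_point proj_space_def by blast
  then show ?thesis
    using P unfolding F by (auto simp: frobenius_def peval_power_card)
qed

lemma frobenius_surj_proj_space:
  assumes "P \<in> (proj_space :: ('n, 'k::{field,finite} alg_closure) proj_point set)"
  shows "\<exists>P'\<in>proj_space. P = frobenius P'"
proof -
  obtain v where v: "v \<noteq> (\<lambda>_. 0)" "P = proj_point v" using assms by (auto simp: proj_space_def)
  have "\<forall>i. \<exists>y. y ^ CARD('k) = v i" using nth_root_exists[of "CARD('k)"] by auto
  then obtain u where u: "\<And>i. u i ^ CARD('k) = v i" by metis
  obtain i where "v i \<noteq> 0" using v(1) by auto
  then have "u i \<noteq> 0" using u[of i] by (auto simp: zero_power)
  then have "u \<noteq> (\<lambda>_. 0)" by auto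
  then show ?thesis
    using v(2) u frobenius_proj_point[of u] unfolding proj_space_def by auto
qed

section \<open>The Frobenius as a group automorphism\<close>

context abelian_variety
begin

lemma closed_carrier: "closed_over (to_ac :: 'k \<Rightarrow> _) (carrier A)"
  using variety by (simp add: projective_variety_def)

lemma carrier_proj_space: "carrier A \<subseteq> proj_space"
  using closed_carrier unfolding closed_over_def by blast

lemma bij_betw_frobenius: "bij_betw frobenius (carrier A) (carrier A)"
  unfolding bij_betw_def
proof
  show "inj_on frobenius (carrier A)"
    using inj_frobenius by (rule inj_on_subset) simp
  show "frobenius ` carrier A = carrier A"
  proof
    show "frobenius ` carrier A \<subseteq> carrier A"
      using frobenius_mem_iff[OF closed_carrier] carrier_proj_space by blast
    show "carrier A \<subseteq> frobenius ` carrier A"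
    proof
      fix P assume P: "P \<in> carrier A"
      then obtain P' where "P' \<in> proj_space" "P = frobenius P'"
        using frobenius_surj_proj_space carrier_proj_space by blast
      then show "P \<in> frobenius ` carrier A"
        using frobenius_mem_iff[OF closed_carrier] P by blast
    qed
  qed
qed

text \<open>Polynomials that describe the multiplication at \<open>P\<close> and \<open>R\<close>
  also do so at their Frobenius images: the values there are powers of the old ones, so one that was
  nonzero stays nonzero. A single \<open>F\<close> thus computes both sides.\<close>

lemma frobenius_mult:
  assumes "P \<in> carrier A" "R \<in> carrier A"
  shows "frobenius (P \<otimes> R) = frobenius P \<otimes> frobenius R"
proof -
  obtain F :: "'n \<Rightarrow> ('n + 'n \<Rightarrow>\<^sub>0 nat) \<Rightarrow>\<^sub>0 'k"
    where nz: "\<forall>v\<in>P. \<forall>w\<in>R. \<exists>j. peval to_ac (F j) (case_sum v w) \<noteq> 0"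
      and F: "\<forall>P'\<in>carrier A. \<forall>Q'\<in>carrier A. \<forall>v\<in>P'. \<forall>w\<in>Q'.
          (\<exists>j. peval to_ac (F j) (case_sum v w) \<noteq> 0)
          \<longrightarrow> P' \<otimes> Q' = proj_point (\<lambda>j. peval to_ac (F j) (case_sum v w))"
    using bspec[OF bspec[OF mult_regular[unfolded regular_map2_def] assms(1)] assms(2)]
    by (elim exE conjE) (rule that)
  have mem: "\<exists>v. v \<in> P" if "P \<in> carrier A" for P
  proof -
    have "P \<in> proj_space" using that carrier_proj_space by blast
    then obtain v where P: "P = proj_point v" unfolding proj_space_def by blast
    have "(\<lambda>i. 1 * v i) \<in> P" unfolding P proj_point_def by (rule CollectI, rule exI[of _ 1]) simp
    then show ?thesis by (intro exI[of _ "\<lambda>i. 1 * v i"])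
  qed
  obtain v w where v: "v \<in> P" and w: "w \<in> R" using mem assms by blast
  let ?fr = "\<lambda>v (i :: 'n). v i ^ CARD('k)"
  have "case_sum (?fr v) (?fr w) = (\<lambda>i. case_sum v w i ^ CARD('k))"
    by (auto split: sum.split)
  then have ev: "peval to_ac (F j) (case_sum (?fr v) (?fr w)) = peval to_ac (F j) (case_sum v w) ^ CARD('k)"
    for j by (simp add: peval_power_card)
  obtain j where "peval to_ac (F j) (case_sum v w) \<noteq> 0" using nz v w by blast
  then have j: "\<exists>j. peval to_ac (F j) (case_sum v w) \<noteq> 0"
    "\<exists>j. peval to_ac (F j) (case_sum (?fr v) (?fr w)) \<noteq> 0"
    unfolding ev by auto
  have fr: "frobenius P \<in> carrier A" "frobenius R \<in> carrier A" "?fr v \<in> frobenius P" "?fr w \<in> frobenius R"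
    using assms v w bij_betw_frobenius by (auto simp: bij_betw_def frobenius_def)
  have "frobenius P \<otimes> frobenius R = proj_point (\<lambda>j. peval to_ac (F j) (case_sum (?fr v) (?fr w)))"
    using F fr j(2) by blast
  also have "\<dots> = frobenius (proj_point (\<lambda>j. peval to_ac (F j) (case_sum v w)))"
    unfolding ev frobenius_proj_point ..
  also have "proj_point (\<lambda>j. peval to_ac (F j) (case_sum v w)) = P \<otimes> R"
    using F assms v w j(1) by metis
  finally show ?thesis ..
qed

lemma frobenius_iso: "frobenius \<in> iso A A"
  using bij_betw_frobenius frobenius_mult by (auto simp: iso_def hom_def bij_betw_def)

end

section \<open>Torsion quandles and the connected sum\<close>

lemma (in comm_group) subgroup_torsion: "subgroup (carrier (torsion_group G n)) G"
  by (rule subgroupI) (auto simp: torsion_group_def nat_pow_inv pow_mult_distrib m_comm)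

lemma (in comm_group) comm_group_torsion: "comm_group (torsion_group G n)"
proof -
  have "torsion_group G n = G\<lparr>carrier := carrier (torsion_group G n)\<rparr>"
    by (simp add: torsion_group_def)
  then have "group (torsion_group G n)"
    using subgroup_imp_group[OF subgroup_torsion[of n]] by metis
  then show ?thesis
    by (rule group.group_comm_groupI) (auto simp: torsion_group_def m_comm)
qed

lemma (in comm_group) iso_torsion:
  assumes "\<phi> \<in> iso G G"
  shows "\<phi> \<in> iso (torsion_group G n) (torsion_group G n)"
proof -
  have hom: "\<phi> \<in> hom G G" and bij: "bij_betw \<phi> (carrier G) (carrier G)"
    using assms by (auto simp: iso_def)
  interpret \<phi>: group_hom G G \<phi>
    using hom by unfold_locales
  have tors: "\<phi> x [^] n = \<one> \<longleftrightarrow> x [^] n = \<one>" if "x \<in> carrier G" for x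
  proof -
    have "\<phi> x [^] n = \<phi> (x [^] n)" using that by (simp add: \<phi>.hom_nat_pow)
    moreover have "\<phi> (x [^] n) = \<phi> \<one> \<longleftrightarrow> x [^] n = \<one>"
      using bij that by (intro inj_on_eq_iff[of \<phi> "carrier G"]) (auto simp: bij_betw_def)
    ultimately show ?thesis by simp
  qed
  have "bij_betw \<phi> {x \<in> carrier G. x [^] n = \<one>} {x \<in> carrier G. x [^] n = \<one>}"
  proof (rule bij_betw_subset[OF bij])
    have "y \<in> \<phi> ` {x \<in> carrier G. x [^] n = \<one>}" if y: "y \<in> carrier G" "y [^] n = \<one>" for y
    proof -
      obtain x where "x \<in> carrier G" "y = \<phi> x" using bij y(1) by (auto simp: bij_betw_def)
      then show ?thesis using tors y(2) by blast
    qed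
    then show "\<phi> ` {x \<in> carrier G. x [^] n = \<one>} = {x \<in> carrier G. x [^] n = \<one>}"
      using tors by auto
  qed auto
  then show ?thesis
    using hom by (auto simp: iso_def torsion_group_def hom_def bij_betw_def)
qed

lemma (in abelian_variety) quandle_torsion_quandle: "quandle (torsion_quandle A l)"
  unfolding torsion_quandle_def
  by (rule alexander_quandle_is_quandle) (simp_all add: comm_group_torsion iso_torsion frobenius_iso)

theorem proposition3p25:
  fixes A :: "('n::finite, 'k::{field,finite} alg_closure) proj_point monoid"
    and K\<^sub>1 K\<^sub>2 K :: knot
  assumes "abelian_variety A"
    and "connected_sum K\<^sub>1 K\<^sub>2 K"
  shows "persistently_colorable A K
    \<longleftrightarrow> persistently_colorable A K\<^sub>1 \<or> persistently_colorable A K\<^sub>2"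
proof -
  interpret abelian_variety A by fact
  obtain w\<^sub>1 w\<^sub>2 where w: "diagram_of w\<^sub>1 K\<^sub>1" "diagram_of w\<^sub>2 K\<^sub>2" "diagram_of (w\<^sub>1 @ w\<^sub>2) K"
    and disj: "crossings w\<^sub>1 \<inter> crossings w\<^sub>2 = {}"
    using assms(2) by (auto simp: connected_sum_def)
  have "knot_diagram w\<^sub>1" using w(1) by (simp add: diagram_of_def)
  \<comment> \<open>Proved for each \<open>l\<close> separately, this makes the primes of the sum
    the union of those of the summands, and such a union is infinite iff one of its two parts
    is.\<close>
  have "(\<exists>f. nonconstant_coloring K (torsion_quandle A l) f) \<longleftrightarrow>
      (\<exists>f. nonconstant_coloring K\<^sub>1 (torsion_quandle A l) f) \<or>
      (\<exists>f. nonconstant_coloring K\<^sub>2 (torsion_quandle A l) f)" for l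
  proof -
    interpret Q: quandle "torsion_quandle A l" by (rule quandle_torsion_quandle)
    interpret T: comm_group "torsion_group A l" by (rule comm_group_torsion)
    \<comment> \<open>The first summand closes up because its own diagram is planar; the second then
      closes up because the whole code does.\<close>
    have "Q.transport g w\<^sub>1 x = x"
      if "x \<in> carrier (torsion_quandle A l)" "range g \<subseteq> carrier (torsion_quandle A l)"
        "Q.compatible g w\<^sub>1 x" for g x
      using T.alexander_transport[OF iso_torsion[OF frobenius_iso] \<open>knot_diagram w\<^sub>1\<close>] that
      by (simp add: torsion_quandle_def)
    from Q.code_colorable_append[OF this disj] show ?thesis
      by (simp only: w[THEN Q.nonconstant_coloring_iff])
  qed
  then have "coloring_primes A K = coloring_primes A K\<^sub>1 \<union> coloring_primes A K\<^sub>2"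
    unfolding coloring_primes_def by auto
  then show ?thesis by (simp add: persistently_colorable_def)
qed

end
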